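(* Under the Setup and the Conditional asymptotic regime described in the context, for $i,j\in\{0,1\}$, $$\lim_{p\to\infty}E_{S_n}[\hat\varepsilon_i^B\varepsilon_j\mid\boldsymbol\mu]=\Phi\!\left((-1)^i\frac{-G_i^B+c}{\sqrt D}\right)\Phi\!\left((-1)^j\frac{-G_j+c}{\sqrt D}\right),$$ and consequently $$\lim_{p\to\infty}E_{S_n}[\hat\varepsilon^B\varepsilon\mid\boldsymbol\mu]=\sum_{i=0}^1\sum_{j=0}^1\alpha_i\alpha_j\,\Phi\!\left((-1)^i\frac{-G_i^B+c}{\sqrt D}\right)\Phi\!\left((-1)^j\frac{-G_j+c}{\sqrt D}\right),$$ where $G_0^B=\frac{1}{2(1+\gamma_0)}\big(\gamma_0(\bar\eta_{\mathbf m_0,\boldsymbol\mu_1}-\bar\eta_{\mathbf m_0,\boldsymbol\mu_0})+\bar\delta^2_{\boldsymbol\mu}+(1-\gamma_0)J_0+(1+\gamma_0)J_1\big)$, $G_1^B=\frac{-1}{2(1+\gamma_1)}\big(\gamma_1(\bar\eta_{\mathbf m_1,\boldsymbol\mu_0}-\bar\eta_{\mathbf m_1,\boldsymbol\mu_1})+\bar\delta^2_{\boldsymbol\mu}+(1-\gamma_1)J_1+(1+\gamma_1)J_0\big)$, $G_0=\frac12(\bar\delta^2_{\boldsymbol\mu}+J_1-J_0)$, $G_1=-\frac12(\bar\delta^2_{\boldsymbol\mu}+J_0-J_1)$, and $D=\bar\delta^2_{\boldsymbol\mu}+J_0+J_1$.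
   Context: Setup. Fix $\alpha_0\in(0,1)$, $\alpha_1=1-\alpha_0$, and $c=\log\frac{1-\alpha_0}{\alpha_0}$. $\Phi$ is the standard normal CDF. For each dimension $p$ there is a known symmetric positive definite $p\times p$ matrix $\Sigma$, class means $\boldsymbol\mu_0,\boldsymbol\mu_1\in\mathbb R^p$, sample sizes $n_0,n_1$, prior means $\mathbf m_0,\mathbf m_1\in\mathbb R^p$ and prior certainty parameters $\nu_0,\nu_1>0$ (all depending on $p$; the index $p$ is suppressed). Class $i$ has distribution $\Pi_i=N(\boldsymbol\mu_i,\Sigma)$. The sample $S_n$ consists of $n_0$ i.i.d. points from $\Pi_0$ and, independently, $n_1$ i.i.d. points from $\Pi_1$; $\bar{\mathbf x}_0,\bar{\mathbf x}_1$ are the class sample means. The LDA classifier assigns $\mathbf x$ to class 1 if $W(\mathbf x)\le c$ and to class 0 otherwise, where $W(\mathbf x)=(\mathbf x-\frac{\bar{\mathbf x}_0+\bar{\mathbf x}_1}{2})^T\Sigma^{-1}(\bar{\mathbf x}_0-\bar{\mathbf x}_1)$. Let $\hat\delta^2=(\bar{\mathbf x}_0-\bar{\mathbf x}_1)^T\Sigma^{-1}(\bar{\mathbf x}_0-\bar{\mathbf x}_1)$. The true error is $\varepsilon=\alpha_0\varepsilon_0+\alpha_1\varepsilon_1$ with $\varepsilon_i=\Phi\Big(\frac{(-1)^{i+1}(\boldsymbol\mu_i-\frac{\bar{\mathbf x}_0+\bar{\mathbf x}_1}{2})^T\Sigma^{-1}(\bar{\mathbf x}_0-\bar{\mathbf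 x}_1)+(-1)^i c}{\hat\delta}\Big)$. The Bayesian MMSE error estimator (for the prior $\boldsymbol\mu_i\sim N(\mathbf m_i,\Sigma/\nu_i)$, $i=0,1$, independent) is $\hat\varepsilon^B=\alpha_0\hat\varepsilon^B_0+\alpha_1\hat\varepsilon^B_1$ with $\hat\varepsilon_i^B=\Phi\Big((-1)^i\frac{-(\mathbf m_i^*-\frac{\bar{\mathbf x}_0+\bar{\mathbf x}_1}{2})^T\Sigma^{-1}(\bar{\mathbf x}_0-\bar{\mathbf x}_1)+c}{\hat\delta}\sqrt{\frac{\nu_i^*}{\nu_i^*+1}}\Big)$, where $\mathbf m_i^*=\frac{n_i\bar{\mathbf x}_i+\nu_i\mathbf m_i}{n_i+\nu_i}$ and $\nu_i^*=n_i+\nu_i$. Notation: $\eta_{\mathbf a,\mathbf b}=(\mathbf a-\mathbf b)^T\Sigma^{-1}(\mathbf a-\mathbf b)$, $\delta^2_{\boldsymbol\mu}=\eta_{\boldsymbol\mu_0,\boldsymbol\mu_1}$; a bar denotes the limit as $p\to\infty$ of the corresponding quantity. Conditional asymptotic regime. $\boldsymbol\mu_0,\boldsymbol\mu_1$ are deterministic for each $p$, and expectations $E_{S_n}[\cdot\mid\boldsymbol\mu]$ are over the sample only. As $p\to\infty$: $n_0,n_1,\nu_0,\nu_1\to\infty$, $p/n_i\to J_i\in[0,\infty)$, $\nu_i/n_i\to\gamma_i\in[0,\infty)$, and for all $i,j\in\{0,1\}$ the quantities $\mathbf m_i^T\Sigma^{-1}\boldsymbol\mu_j$, $\mathbf m_i^T\Sigma^{-1}\mathbf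 m_j$, $\boldsymbol\mu_i^T\Sigma^{-1}\boldsymbol\mu_j$ converge to finite limits (so all the $\eta$'s above converge). It is assumed that $D=\bar\delta^2_{\boldsymbol\mu}+J_0+J_1>0$. $\lim_{p\to\infty}$ denotes the limit along this regime. *)

theory Defs
  imports "HOL-Probability.Probability"
begin

text \<open>Vectors of R^p are represented as functions nat => real (only indices < p matter),
  p x p matrices as functions nat => nat => real (only indices < p matter),
  because the dimension p varies along the asymptotic regime.\<close>

type_synonym rvec = "nat \<Rightarrow> real"
type_synonym rmat = "nat \<Rightarrow> nat \<Rightarrow> real"

definition Phi :: "real \<Rightarrow> real" where
  "Phi x = measure (density lborel std_normal_density) {..x}"

definition mdet :: "nat \<Rightarrow> rmat \<Rightarrow> real" where
  "mdet p S = (\<Sum>\<sigma> | \<sigma> permutes {..<p}. of_int (sign \<sigma>) * (\<Prod>i<p. S i (\<sigma> i)))"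

definition minv :: "nat \<Rightarrow> rmat \<Rightarrow> rmat" where
  "minv p S = (THE B. (\<forall>i j. (p \<le> i \<or> p \<le> j) \<longrightarrow> B i j = 0) \<and>
      (\<forall>i<p. \<forall>j<p. (\<Sum>k<p. S i k * B k j) = (if i = j then 1 else 0)))"

definition sym_posdef :: "nat \<Rightarrow> rmat \<Rightarrow> bool" where
  "sym_posdef p S \<longleftrightarrow> (\<forall>i<p. \<forall>j<p. S i j = S j i) \<and>
     (\<forall>x::rvec. (\<exists>i<p. x i \<noteq> 0) \<longrightarrow> (\<Sum>i<p. \<Sum>j<p. x i * S i j * x j) > 0)"

definition bil :: "nat \<Rightarrow> rmat \<Rightarrow> rvec \<Rightarrow> rvec \<Rightarrow> real" where
  "bil p S a b = (\<Sum>i<p. \<Sum>j<p. a i * minv p S i j * b j)"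

definition eta :: "nat \<Rightarrow> rmat \<Rightarrow> rvec \<Rightarrow> rvec \<Rightarrow> real" where
  "eta p S a b = bil p S (\<lambda>k. a k - b k) (\<lambda>k. a k - b k)"

definition mvn_density :: "nat \<Rightarrow> rvec \<Rightarrow> rmat \<Rightarrow> rvec \<Rightarrow> real" where
  "mvn_density p mu S x =
     exp (- (1/2) * bil p S (\<lambda>k. x k - mu k) (\<lambda>k. x k - mu k)) / sqrt ((2 * pi) ^ p * mdet p S)"

definition mvn :: "nat \<Rightarrow> rvec \<Rightarrow> rmat \<Rightarrow> rvec measure" where
  "mvn p mu S = density (PiM {..<p} (\<lambda>_. lborel)) (\<lambda>x. ennreal (mvn_density p mu S x))"

definition sample_meas :: "nat \<Rightarrow> rmat \<Rightarrow> rvec \<Rightarrow> rvec \<Rightarrow> nat \<Rightarrow> nat \<Rightarrow>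
    ((nat \<Rightarrow> rvec) \<times> (nat \<Rightarrow> rvec)) measure" where
  "sample_meas p S mu0 mu1 n0 n1 =
     (PiM {..<n0} (\<lambda>_. mvn p mu0 S)) \<Otimes>\<^sub>M (PiM {..<n1} (\<lambda>_. mvn p mu1 S))"

definition smean :: "nat \<Rightarrow> nat \<Rightarrow> (nat \<Rightarrow> rvec) \<Rightarrow> rvec" where
  "smean p n X = (\<lambda>k. if k < p then (\<Sum>t<n. X t k) / real n else 0)"

definition lda_c :: "real \<Rightarrow> real" where
  "lda_c a0 = ln ((1 - a0) / a0)"

definition alpha :: "real \<Rightarrow> nat \<Rightarrow> real" where
  "alpha a0 i = (if i = 0 then a0 else 1 - a0)"

definition lda_arg :: "nat \<Rightarrow> rmat \<Rightarrow> rvec \<Rightarrow> rvec \<Rightarrow> rvec \<Rightarrow> real" where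
  "lda_arg p S v xb0 xb1 = bil p S (\<lambda>k. v k - (xb0 k + xb1 k) / 2) (\<lambda>k. xb0 k - xb1 k)"

definition dhat :: "nat \<Rightarrow> rmat \<Rightarrow> rvec \<Rightarrow> rvec \<Rightarrow> real" where
  "dhat p S xb0 xb1 = sqrt (eta p S xb0 xb1)"

definition eps_true :: "real \<Rightarrow> nat \<Rightarrow> rmat \<Rightarrow> rvec \<Rightarrow> rvec \<Rightarrow> nat \<Rightarrow> rvec \<Rightarrow> rvec \<Rightarrow> real" where
  "eps_true a0 p S mu0 mu1 i xb0 xb1 =
     Phi (((-1) ^ (i + 1) * lda_arg p S (if i = 0 then mu0 else mu1) xb0 xb1 + (-1) ^ i * lda_c a0)
          / dhat p S xb0 xb1)"

definition eps_bayes :: "real \<Rightarrow> nat \<Rightarrow> rmat \<Rightarrow> rvec \<Rightarrow> rvec \<Rightarrow> nat \<Rightarrow> nat \<Rightarrow> real \<Rightarrow> real \<Rightarrow>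
    nat \<Rightarrow> rvec \<Rightarrow> rvec \<Rightarrow> real" where
  "eps_bayes a0 p S m0 m1 n0 n1 nu0 nu1 i xb0 xb1 =
     (let ni = real (if i = 0 then n0 else n1);
          nui = (if i = 0 then nu0 else nu1);
          mi = (if i = 0 then m0 else m1);
          xbi = (if i = 0 then xb0 else xb1);
          mstar = (\<lambda>k. (ni * xbi k + nui * mi k) / (ni + nui));
          nustar = ni + nui
      in Phi ((-1) ^ i * ((- lda_arg p S mstar xb0 xb1 + lda_c a0) / dhat p S xb0 xb1)
              * sqrt (nustar / (nustar + 1))))"

definition eps_true_tot :: "real \<Rightarrow> nat \<Rightarrow> rmat \<Rightarrow> rvec \<Rightarrow> rvec \<Rightarrow> rvec \<Rightarrow> rvec \<Rightarrow> real" where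
  "eps_true_tot a0 p S mu0 mu1 xb0 xb1 =
     a0 * eps_true a0 p S mu0 mu1 0 xb0 xb1 + (1 - a0) * eps_true a0 p S mu0 mu1 1 xb0 xb1"

definition eps_bayes_tot :: "real \<Rightarrow> nat \<Rightarrow> rmat \<Rightarrow> rvec \<Rightarrow> rvec \<Rightarrow> nat \<Rightarrow> nat \<Rightarrow> real \<Rightarrow> real \<Rightarrow>
    rvec \<Rightarrow> rvec \<Rightarrow> real" where
  "eps_bayes_tot a0 p S m0 m1 n0 n1 nu0 nu1 xb0 xb1 =
     a0 * eps_bayes a0 p S m0 m1 n0 n1 nu0 nu1 0 xb0 xb1
     + (1 - a0) * eps_bayes a0 p S m0 m1 n0 n1 nu0 nu1 1 xb0 xb1"

end

theory Submission
  imports Defs "Jordan_Normal_Form.Determinant"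
begin

text \<open>
  Write \<open>\<Sigma> = U U\<^sup>T\<close> with \<open>U\<close> upper triangular and \<open>C = U\<inverse>\<close>. Then \<open>a\<^sup>T \<Sigma>\<inverse> b = C a \<bullet> C b\<close>, and in
  the coordinates \<open>C (x - \<mu>)\<close> the normal law becomes a product of standard normals. The
  coordinates \<open>W\<^sub>k\<close> of the whitened error of a sample mean are therefore pairwise independent and
  \<open>N(0, 1/n)\<close> distributed, and second moments can be computed exactly: a linear functional of the
  error has second moment of order \<open>1/n\<close>, \<open>\<Sum>\<^sub>k W\<^sub>k\<^sup>2\<close> has mean \<open>p/n\<close> and variance \<open>2p/n\<^sup>2\<close>, and the
  cross term of the two classes has second moment \<open>p/(n\<^sub>0 n\<^sub>1)\<close>. By Chebyshev's inequality all
  bilinear statistics of the sample means converge in probability. The error and its estimator are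
  continuous functions of these statistics with values in \<open>[0, 1]\<close>, so the expectations converge to
  the product of the limits.
\<close>

section \<open>Whitening of the normal distribution\<close>

text \<open>All limits are constants, so convergence in probability can be combined without knowing
  any joint law of the statistics, and boundedness of the errors turns it into convergence of
  expectations. Hence second moments of the statistics suffice, and for these pairwise independence
  of the coordinates is enough. The only mean that survives is that of the squared sample mean
  error, p/n_i, with limit J_i. It enters D through the distance of the two sample means and G_i
  through their midpoint. In the estimator the true mean mu_i is replaced by xbar_i and m_i with
  limiting weights 1/(1 + gamma_i) and gamma_i/(1 + gamma_i); pairing xbar_i with itself brings in a
  further J_i. This and the prior mean make up the gap between G_i^B and G_i. The factor of the
  covariance is triangular so that the change of variables reduces to one-dimensional affine
  substitutions. A sample size may be 0 for small p, so the moment formulas are available only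
  eventually.\<close>

definition cholesky_factor :: "nat \<Rightarrow> rmat \<Rightarrow> rmat \<Rightarrow> bool" where
  "cholesky_factor p S U \<longleftrightarrow> (\<forall>i<p. U i i > 0) \<and> (\<forall>i<p. \<forall>j<i. U i j = 0) \<and>
    (\<forall>i<p. \<forall>j<p. S i j = (\<Sum>k<p. U i k * U j k))"

text \<open>Induction that splits off the last coordinate instead of the first: the factor of the
  smaller problem stays the leading block, and the result is upper rather than lower
  triangular.\<close>

lemma sym_posdef_cholesky:
  assumes "sym_posdef p S"
  shows "\<exists>U. cholesky_factor p S U"
  using assms
proof (induction p arbitrary: S)
  case 0
  then show ?case by (simp add: cholesky_factor_def)
next
  case (Suc p)
  have sym: "S i j = S j i" if "i < Suc p" "j < Suc p" for i j
    using Suc.prems that unfolding sym_posdef_def by blast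
  have pos: "(\<Sum>i<Suc p. \<Sum>j<Suc p. x i * S i j * x j) > 0" if "\<exists>i<Suc p. x i \<noteq> 0" for x
    using Suc.prems that unfolding sym_posdef_def by blast
  have quad: "(\<Sum>i<Suc p. \<Sum>j<Suc p. x i * S i j * x j) =
     (\<Sum>i<p. \<Sum>j<p. x i * S i j * x j) + 2 * x p * (\<Sum>i<p. x i * S i p) + (x p)\<^sup>2 * S p p" for x
  proof -
    have "(\<Sum>j<p. x p * S p j * x j) = x p * (\<Sum>i<p. x i * S i p)"
      unfolding sum_distrib_left by (intro sum.cong) (auto simp: sym[of p])
    moreover have "(\<Sum>i<p. x i * S i p * x p) = x p * (\<Sum>i<p. x i * S i p)"
      unfolding sum_distrib_left by (intro sum.cong) auto
    ultimately show ?thesis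
      by (simp add: sum.distrib power2_eq_square algebra_simps)
  qed
  define s where "s = S p p"
  have "s > 0"
    using pos[of "\<lambda>i. if i = p then 1 else 0"] by (simp add: quad s_def)
  \<comment> \<open>eliminate the last coordinate: the Schur complement of the last diagonal entry\<close>
  define S' where "S' = (\<lambda>i j. S i j - S i p * S j p / s)"
  have "sym_posdef p S'"
    unfolding sym_posdef_def
  proof (intro conjI allI impI)
    fix i j assume "i < p" "j < p"
    then show "S' i j = S' j i" by (simp add: S'_def sym[of i j])
  next
    fix x :: rvec assume x: "\<exists>i<p. x i \<noteq> 0"
    define t where "t = (\<Sum>i<p. x i * S i p)"
    \<comment> \<open>The entry \<open>- t / s\<close> minimises the quadratic form in the last
      coordinate; the minimum is the form of \<open>S'\<close> at \<open>x\<close>.\<close>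
    define y where "y = x(p := - t / s)"
    have "0 < (\<Sum>i<Suc p. \<Sum>j<Suc p. y i * S i j * y j)"
      using x by (intro pos) (auto simp: y_def less_Suc_eq)
    also have "\<dots> = (\<Sum>i<p. \<Sum>j<p. x i * S i j * x j) - t\<^sup>2 / s"
    proof -
      have "(\<Sum>i<p. \<Sum>j<p. y i * S i j * y j) = (\<Sum>i<p. \<Sum>j<p. x i * S i j * x j)"
        "(\<Sum>i<p. y i * S i p) = t"
        by (simp_all add: y_def t_def)
      moreover have "2 * (- t / s) * t + (- t / s)\<^sup>2 * s = - (t\<^sup>2 / s)"
        using \<open>s > 0\<close> by (simp add: power2_eq_square field_simps)
      ultimately show ?thesis
        unfolding quad by (simp add: y_def s_def)
    qed
    also have "t\<^sup>2 / s = (\<Sum>i<p. \<Sum>j<p. x i * (S i p * S j p / s) * x j)"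
      unfolding power2_eq_square t_def sum_product sum_divide_distrib
      by (intro sum.cong refl) simp
    finally show "(\<Sum>i<p. \<Sum>j<p. x i * S' i j * x j) > 0"
      by (simp add: S'_def sum_subtractf algebra_simps)
  qed
  from Suc.IH[OF this] obtain U where "cholesky_factor p S' U" ..
  then have U: "\<And>i. i < p \<Longrightarrow> U i i > 0" "\<And>i j. i < p \<Longrightarrow> j < i \<Longrightarrow> U i j = 0"
    "\<And>i j. i < p \<Longrightarrow> j < p \<Longrightarrow> S' i j = (\<Sum>k<p. U i k * U j k)"
    unfolding cholesky_factor_def by simp_all
  \<comment> \<open>Column \<open>p\<close> contributes \<open>S i p * S j p / s\<close>, exactly
    what was subtracted in \<open>S'\<close>; row \<open>p\<close> is zero off the diagonal, which
    keeps the factor upper triangular.\<close>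
  define V :: rmat where
    "V = (\<lambda>i j. if j = p then S i p / sqrt s else if i = p then 0 else U i j)"
  have sq: "sqrt s * sqrt s = s" "\<bar>s\<bar> = s" using \<open>s > 0\<close> by simp_all
  have "cholesky_factor (Suc p) S V"
    unfolding cholesky_factor_def
  proof (intro conjI allI impI)
    fix i assume "i < Suc p" then show "V i i > 0"
      using U(1) \<open>s > 0\<close> by (auto simp: V_def less_Suc_eq s_def[symmetric])
  next
    fix i j assume "i < Suc p" "j < i" then show "V i j = 0"
      using U(2) by (auto simp: V_def less_Suc_eq)
  next
    fix i j assume ij: "i < Suc p" "j < Suc p"
    have "(\<Sum>k<p. V i k * V j k) = (if i = p \<or> j = p then 0 else S' i j)"
      using U(3) ij by (auto simp: V_def less_Suc_eq)
    moreover have "S i p * S j p / s = S i j" if "i = p \<or> j = p"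
      using that sym[of i j] ij \<open>s > 0\<close> by (auto simp: s_def)
    ultimately show "S i j = (\<Sum>k<Suc p. V i k * V j k)"
      by (auto simp: V_def S'_def sq)
  qed
  then show ?case by blast
qed

section \<open>Determinant, inverse and bilinear form in terms of the triangular factor\<close>

lemma mdet_eq_det: "mdet p S = Determinant.det (Matrix.mat p p (\<lambda>(i, j). S i j))"
proof -
  have "(\<Prod>i = 0..<p. Matrix.mat p p (\<lambda>(i, j). S i j) $$ (i, \<sigma> i)) = (\<Prod>i<p. S i (\<sigma> i))"
    if "\<sigma> permutes {..<p}" for \<sigma>
    using permutes_in_image[OF that]
    by (auto intro!: prod.cong simp: atLeast0LessThan)
  then show ?thesis
    unfolding mdet_def by (subst Determinant.det_def'[of _ p]) (auto simp: atLeast0LessThan)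
qed

text \<open>Evaluates the definite description in \<open>minv\<close>. A right inverse of a square
  matrix is also a left inverse, so two right inverses agree by associativity; the zeros outside the
  block make the functions equal and not only their p x p parts.\<close>

lemma minv_unique:
  assumes zero: "\<And>i j. p \<le> i \<or> p \<le> j \<Longrightarrow> B i j = 0"
    and inv: "\<And>i j. i < p \<Longrightarrow> j < p \<Longrightarrow> (\<Sum>k<p. S i k * B k j) = (if i = j then 1 else 0)"
  shows "minv p S = B"
  unfolding minv_def
proof (rule the_equality)
  show "(\<forall>i j. p \<le> i \<or> p \<le> j \<longrightarrow> B i j = 0) \<and>
    (\<forall>i<p. \<forall>j<p. (\<Sum>k<p. S i k * B k j) = (if i = j then 1 else 0))"
    using zero inv by simp
next
  fix B' assume B': "(\<forall>i j. p \<le> i \<or> p \<le> j \<longrightarrow> B' i j = 0) \<and>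
    (\<forall>i<p. \<forall>j<p. (\<Sum>k<p. S i k * B' k j) = (if i = j then 1 else 0))"
  let ?M = "\<lambda>S. Matrix.mat p p (\<lambda>(i, j). S i j)"
  have right: "?M S * ?M X = 1\<^sub>m p"
    if "\<And>i j. i < p \<Longrightarrow> j < p \<Longrightarrow> (\<Sum>k<p. S i k * X k j) = (if i = j then 1 else 0)" for X
    using that by (intro eq_matI) (auto simp: scalar_prod_def atLeast0LessThan)
  have "?M B' = (?M B * ?M S) * ?M B'"
    using mat_mult_left_right_inverse[OF _ _ right[OF inv]] by simp
  also have "\<dots> = ?M B * (?M S * ?M B')"
    by (rule assoc_mult_mat[of _ p p _ p _ p]) auto
  also have "\<dots> = ?M B"
    using right[of B'] B' by simp
  finally have eq: "?M B' = ?M B" .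
  show "B' = B"
  proof (intro ext)
    fix i j
    show "B' i j = B i j"
    proof (cases "i < p \<and> j < p")
      case True
      then have "B' i j = ?M B' $$ (i, j)" "B i j = ?M B $$ (i, j)" by simp_all
      then show ?thesis by (simp only: eq)
    next
      case False
      then show ?thesis using B' zero[of i j] by (auto simp: not_less)
    qed
  qed
qed

text \<open>Of the factorisation of \<open>S\<close> only the determinant and the bilinear form are
  recorded, since \<open>mvn_density\<close> depends on \<open>S\<close> through these
  alone.\<close>

definition inverse_factor :: "nat \<Rightarrow> rmat \<Rightarrow> rmat \<Rightarrow> rmat \<Rightarrow> bool" where
  "inverse_factor p S U C \<longleftrightarrow> (\<forall>i<p. U i i > 0) \<and> (\<forall>i<p. \<forall>j<i. U i j = 0) \<and>
    (\<forall>i<p. \<forall>j<p. (\<Sum>k<p. C i k * U k j) = (if i = j then 1 else 0)) \<and>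
    mdet p S = (\<Prod>i<p. U i i)\<^sup>2 \<and>
    (\<forall>a b. bil p S a b = (\<Sum>k<p. (\<Sum>i<p. C k i * a i) * (\<Sum>i<p. C k i * b i)))"

lemma sym_posdef_inverse_factor:
  assumes "sym_posdef p S"
  shows "\<exists>U C. inverse_factor p S U C"
proof -
  from sym_posdef_cholesky[OF assms] obtain U where "cholesky_factor p S U" ..
  then have U: "\<And>i. i < p \<Longrightarrow> U i i > 0" "\<And>i j. i < p \<Longrightarrow> j < i \<Longrightarrow> U i j = 0"
    and S: "\<And>i j. i < p \<Longrightarrow> j < p \<Longrightarrow> S i j = (\<Sum>k<p. U i k * U j k)"
    unfolding cholesky_factor_def by simp_all
  let ?M = "\<lambda>S. Matrix.mat p p (\<lambda>(i, j). S i j)"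
  have "Determinant.det (?M U) = prod_list (diag_mat (?M U))"
    using U(2) by (intro det_upper_triangular[of _ p]) (auto simp: upper_triangular_def)
  also have "\<dots> = (\<Prod>i<p. U i i)"
    by (subst prod_list_diag_prod) (simp add: atLeast0LessThan)
  finally have detU: "Determinant.det (?M U) = (\<Prod>i<p. U i i)" .
  have "?M S = ?M U * transpose_mat (?M U)"
    using S by (intro eq_matI) (auto simp: scalar_prod_def atLeast0LessThan)
  then have det: "mdet p S = (\<Prod>i<p. U i i)\<^sup>2"
    by (simp add: mdet_eq_det det_mult[of _ p] det_transpose[of _ p] detU power2_eq_square)
  have "(\<Prod>i<p. U i i) > 0"
    using U(1) by (intro prod_pos) auto
  then have "Determinant.det (?M U) \<noteq> 0"
    unfolding detU by linarith
  \<comment> \<open>The argument \<open>()\<close> fills the record extension of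
    \<open>ring_mat\<close>.\<close>
  from det_non_zero_imp_unit[OF _ this, of p "()"] obtain X where
    X: "X \<in> carrier_mat p p" "X * ?M U = 1\<^sub>m p" "?M U * X = 1\<^sub>m p"
    by (auto simp: Units_def ring_mat_def)
  define C where "C = (\<lambda>i j. X $$ (i, j))"
  have CU: "(\<Sum>k<p. C i k * U k j) = (if i = j then 1 else 0)" if "i < p" "j < p" for i j
    using X(1) that arg_cong[OF X(2), of "\<lambda>A. A $$ (i, j)"]
    by (simp add: scalar_prod_def atLeast0LessThan C_def)
  have UC: "(\<Sum>k<p. U i k * C k j) = (if i = j then 1 else 0)" if "i < p" "j < p" for i j
    using X(1) that arg_cong[OF X(3), of "\<lambda>A. A $$ (i, j)"]
    by (simp add: scalar_prod_def atLeast0LessThan C_def)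
  \<comment> \<open>The inverse of U U^T is C^T C, padded with zeros as \<open>minv\<close>
    demands.\<close>
  define B where "B = (\<lambda>i j. if i < p \<and> j < p then \<Sum>k<p. C k i * C k j else 0)"
  have "minv p S = B"
  proof (rule minv_unique)
    fix i j assume ij: "i < p" "j < p"
    \<comment> \<open>U U^T C^T C is regrouped so that the inner sum over \<open>k\<close> is the
      transposed product C U = 1; what remains is U C = 1.\<close>
    have "(\<Sum>k<p. S i k * B k j) = (\<Sum>k<p. (\<Sum>l<p. U i l * U k l) * (\<Sum>m<p. C m k * C m j))"
      using ij by (intro sum.cong) (auto simp: S B_def)
    also have "\<dots> = (\<Sum>k<p. \<Sum>l<p. \<Sum>m<p. U i l * (C m k * U k l) * C m j)"
      unfolding sum_product by (intro sum.cong refl) (simp add: mult_ac)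
    also have "\<dots> = (\<Sum>l<p. \<Sum>m<p. \<Sum>k<p. U i l * (C m k * U k l) * C m j)"
      by (rule trans[OF sum.swap], rule sum.cong[OF refl], rule sum.swap)
    also have "\<dots> = (\<Sum>l<p. \<Sum>m<p. U i l * (\<Sum>k<p. C m k * U k l) * C m j)"
      by (simp add: sum_distrib_left sum_distrib_right)
    also have "\<dots> = (\<Sum>l<p. \<Sum>m<p. if m = l then U i l * C m j else 0)"
      by (intro sum.cong refl) (auto simp: CU)
    also have "\<dots> = (if i = j then 1 else 0)"
      using UC[OF ij] by simp
    finally show "(\<Sum>k<p. S i k * B k j) = (if i = j then 1 else 0)" .
  qed (auto simp: B_def)
  then have "bil p S a b = (\<Sum>k<p. (\<Sum>i<p. C k i * a i) * (\<Sum>i<p. C k i * b i))" for a b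
  proof -
    have "bil p S a b = (\<Sum>i<p. \<Sum>j<p. a i * (\<Sum>k<p. C k i * C k j) * b j)"
      using \<open>minv p S = B\<close> by (auto simp: bil_def B_def intro!: sum.cong)
    also have "\<dots> = (\<Sum>i<p. \<Sum>j<p. \<Sum>k<p. (C k i * a i) * (C k j * b j))"
      by (simp add: sum_distrib_left sum_distrib_right mult_ac)
    also have "\<dots> = (\<Sum>i<p. \<Sum>k<p. \<Sum>j<p. (C k i * a i) * (C k j * b j))"
      by (rule sum.cong[OF refl], rule sum.swap)
    also have "\<dots> = (\<Sum>k<p. \<Sum>i<p. \<Sum>j<p. (C k i * a i) * (C k j * b j))"
      by (rule sum.swap)
    finally show ?thesis by (simp add: sum_product)
  qed
  with U CU det have "inverse_factor p S U C" unfolding inverse_factor_def by simp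
  then show ?thesis by blast
qed

text \<open>The substitution x = mu + U z, one coordinate at a time. The last coordinate of x
  depends on the last coordinate of z only, so it can be substituted first, with derivative
  \<open>U p p\<close>; once it is fixed it merely shifts the other coordinates. The shift is why
  \<open>mu\<close> is generalised in the induction.\<close>

lemma nn_integral_PiM_lborel_upper_triangular:
  fixes U :: rmat
  assumes "\<And>i. i < p \<Longrightarrow> U i i > 0" "\<And>i j. i < p \<Longrightarrow> j < i \<Longrightarrow> U i j = 0"
    and "f \<in> borel_measurable (PiM {..<p} (\<lambda>_. lborel))"
  shows "(\<integral>\<^sup>+x. f x \<partial>PiM {..<p} (\<lambda>_. lborel)) =
    ennreal (\<Prod>i<p. U i i) *
      (\<integral>\<^sup>+z. f (\<lambda>i\<in>{..<p}. mu i + (\<Sum>k<p. U i k * z k)) \<partial>PiM {..<p} (\<lambda>_. lborel))"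
  using assms
proof (induction p arbitrary: f mu)
  case 0
  show ?case
    unfolding lessThan_0 PiM_empty
    by (subst (1 2) nn_integral_count_space_finite) (simp_all add: restrict_def)
next
  case (Suc p)
  interpret product_sigma_finite "\<lambda>_::nat. lborel :: real measure" ..
  interpret finite_product_sigma_finite "\<lambda>_::nat. lborel :: real measure" "{..<p}" by standard simp
  let ?L = "\<lambda>p::nat. PiM {..<p} (\<lambda>_. lborel :: real measure)"
  let ?aff = "\<lambda>p (mu::rvec) z. \<lambda>i\<in>{..<p}. mu i + (\<Sum>k<p. U i k * z k)"
  have f[measurable]: "f \<in> borel_measurable (PiM (insert p {..<p}) (\<lambda>_. lborel))"
    using Suc.prems(3) by (simp add: lessThan_Suc)
  have Upp: "U p p > 0" using Suc.prems(1) by simp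
  have PU: "(\<Prod>i<p. U i i) \<ge> 0" using Suc.prems(1) by (intro prod_nonneg) (auto intro: less_imp_le)
  have upd[measurable]: "(\<lambda>(y, x). x(p := y)) \<in> borel \<Otimes>\<^sub>M ?L p \<rightarrow>\<^sub>M PiM (insert p {..<p}) (\<lambda>_. lborel)"
    unfolding case_prod_beta' by (rule measurable_fun_upd[of _ "{..<p}"]) auto
  have upd1: "(\<lambda>x. x(p := c)) \<in> ?L p \<rightarrow>\<^sub>M PiM (insert p {..<p}) (\<lambda>_. lborel)" for c
    by (rule measurable_fun_upd[of _ "{..<p}"]) auto
  have [measurable]: "(\<lambda>z. ?aff p m z) \<in> ?L p \<rightarrow>\<^sub>M ?L p" for m
    by (intro measurable_restrict) auto
  have "(\<integral>\<^sup>+x. f x \<partial>?L (Suc p)) = (\<integral>\<^sup>+y. (\<integral>\<^sup>+x. f (x(p := y)) \<partial>?L p) \<partial>lborel)"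
    by (subst lessThan_Suc, subst product_nn_integral_insert_rev) auto
  also have "\<dots> = U p p * (\<integral>\<^sup>+y. (\<integral>\<^sup>+x. f (x(p := mu p + U p p * y)) \<partial>?L p) \<partial>lborel)"
    using Upp by (subst nn_integral_real_affine[of _ "U p p" "mu p"]) auto
  \<comment> \<open>For fixed \<open>y\<close> this is the induction hypothesis with the mean moved
    by \<open>y\<close> times the last column of \<open>U\<close>.\<close>
  also have "(\<integral>\<^sup>+y. (\<integral>\<^sup>+x. f (x(p := mu p + U p p * y)) \<partial>?L p) \<partial>lborel) =
    (\<integral>\<^sup>+y. ennreal (\<Prod>i<p. U i i) *
      (\<integral>\<^sup>+z. f ((?aff p (\<lambda>i. mu i + U i p * y) z)(p := mu p + U p p * y)) \<partial>?L p) \<partial>lborel)"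
    by (intro nn_integral_cong Suc.IH measurable_compose[OF upd1 f]) (use Suc.prems in auto)
  also have "\<dots> = (\<integral>\<^sup>+y. ennreal (\<Prod>i<p. U i i) *
      (\<integral>\<^sup>+z. f (?aff (Suc p) mu (z(p := y))) \<partial>?L p) \<partial>lborel)"
  proof -
    have "(?aff p (\<lambda>i. mu i + U i p * y) z)(p := mu p + U p p * y) = ?aff (Suc p) mu (z(p := y))" for y z
    proof
      fix i
      have "(\<Sum>k<p. U p k * z k) = 0" using Suc.prems(2) by simp
      then show "((?aff p (\<lambda>i. mu i + U i p * y) z)(p := mu p + U p p * y)) i = ?aff (Suc p) mu (z(p := y)) i"
        by auto
    qed
    then show ?thesis by simp
  qed
  also have "\<dots> = ennreal (\<Prod>i<p. U i i) * (\<integral>\<^sup>+y. (\<integral>\<^sup>+z. f (?aff (Suc p) mu (z(p := y))) \<partial>?L p) \<partial>lborel)"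
  proof (rule nn_integral_cmult)
    have [measurable]: "?aff (Suc p) mu \<in> PiM (insert p {..<p}) (\<lambda>_. lborel) \<rightarrow>\<^sub>M PiM (insert p {..<p}) (\<lambda>_. lborel)"
      unfolding lessThan_Suc[symmetric] by (intro measurable_restrict) auto
    show "(\<lambda>y. \<integral>\<^sup>+z. f (?aff (Suc p) mu (z(p := y))) \<partial>?L p) \<in> borel_measurable lborel"
      by measurable
  qed
  also have "(\<integral>\<^sup>+y. (\<integral>\<^sup>+z. f (?aff (Suc p) mu (z(p := y))) \<partial>?L p) \<partial>lborel) =
      (\<integral>\<^sup>+z. f (?aff (Suc p) mu z) \<partial>?L (Suc p))"
  proof -
    have "?aff (Suc p) mu \<in> PiM (insert p {..<p}) (\<lambda>_. lborel) \<rightarrow>\<^sub>M PiM (insert p {..<p}) (\<lambda>_. lborel)"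
      unfolding lessThan_Suc[symmetric] by (intro measurable_restrict) auto
    then have "(\<lambda>z. f (?aff (Suc p) mu z)) \<in> borel_measurable (PiM (insert p {..<p}) (\<lambda>_. lborel))"
      by measurable
    from product_nn_integral_insert_rev[OF _ _ this] show ?thesis
      by (simp only: lessThan_Suc finite_lessThan lessThan_iff less_irrefl simp_thms)
  qed
  also have "ennreal (U p p) * (ennreal (\<Prod>i<p. U i i) * I) = ennreal (\<Prod>i<Suc p. U i i) * I" for I
    using Upp PU by (simp add: ennreal_mult' mult_ac)
  finally show ?case .
qed

lemma sets_mvn [measurable_cong]: "sets (mvn p mu S) = sets (PiM {..<p} (\<lambda>_. borel))"
  by (simp add: mvn_def cong: sets_PiM_cong)

lemma measurable_bil [measurable (raw)]:
  assumes "\<And>k. k < p \<Longrightarrow> (\<lambda>x. f x k) \<in> borel_measurable M"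
    and "\<And>k. k < p \<Longrightarrow> (\<lambda>x. g x k) \<in> borel_measurable M"
  shows "(\<lambda>x. bil p S (f x) (g x)) \<in> borel_measurable M"
  unfolding bil_def using assms by (intro borel_measurable_sum borel_measurable_times) auto

lemma indicator_PiE_restrict:
  assumes "finite I"
  shows "(indicator (Pi\<^sub>E I A) (restrict z I) :: ennreal) = (\<Prod>i\<in>I. indicator (A i) (z i))"
proof (cases "\<forall>i\<in>I. z i \<in> A i")
  case True
  then show ?thesis by (simp add: PiE_iff)
next
  case False
  then obtain i where "i \<in> I" "z i \<notin> A i" by blast
  then have "(\<Prod>i\<in>I. indicator (A i) (z i)) = (0 :: ennreal)"
    using assms by (intro prod_zero bexI[of _ i]) auto
  moreover have "restrict z I \<notin> Pi\<^sub>E I A"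
    using \<open>i \<in> I\<close> \<open>z i \<notin> A i\<close> by (auto simp: PiE_iff)
  ultimately show ?thesis by simp
qed

text \<open>\<open>C\<close> is fixed before \<open>mu\<close>: the same matrix whitens both
  classes, which is what makes the cross term of their errors computable.\<close>

definition whitens :: "nat \<Rightarrow> rmat \<Rightarrow> rmat \<Rightarrow> bool" where
  "whitens p S C \<longleftrightarrow>
    (\<forall>a b. bil p S a b = (\<Sum>k<p. (\<Sum>i<p. C k i * a i) * (\<Sum>i<p. C k i * b i))) \<and>
    (\<forall>mu. distr (mvn p mu S) (PiM {..<p} (\<lambda>_. borel)) (\<lambda>x. \<lambda>k\<in>{..<p}. \<Sum>i<p. C k i * (x i - mu i)) =
       PiM {..<p} (\<lambda>_. std_normal_distribution))"

text \<open>A finite product measure is determined by its values on boxes. On a box, the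
  substitution inverse to the whitening map turns the exponent into a sum of squares, and its
  Jacobian, the product of the \<open>U i i\<close>, cancels the root of the determinant in the
  density.\<close>

lemma mvn_whitening:
  assumes "sym_posdef p S"
  shows "\<exists>C. whitens p S C"
proof -
  obtain U C where UC: "inverse_factor p S U C"
    using sym_posdef_inverse_factor[OF assms] by blast
  then have U: "\<And>i. i < p \<Longrightarrow> U i i > 0" "\<And>i j. i < p \<Longrightarrow> j < i \<Longrightarrow> U i j = 0"
    and CU: "\<And>i j. i < p \<Longrightarrow> j < p \<Longrightarrow> (\<Sum>k<p. C i k * U k j) = (if i = j then 1 else 0)"
    and det: "mdet p S = (\<Prod>i<p. U i i)\<^sup>2"
    and bil: "bil p S a b = (\<Sum>k<p. (\<Sum>i<p. C k i * a i) * (\<Sum>i<p. C k i * b i))" for a b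
    unfolding inverse_factor_def by simp_all
  interpret product_sigma_finite "\<lambda>_::nat. lborel :: real measure" ..
  interpret N: product_prob_space "\<lambda>_::nat. std_normal_distribution" UNIV
    by (intro product_prob_spaceI prob_space_normal_density) simp
  let ?L = "PiM {..<p} (\<lambda>_. lborel :: real measure)"
  have PU: "(\<Prod>i<p. U i i) > 0" using U(1) by (intro prod_pos) auto
  have "distr (mvn p mu S) (PiM {..<p} (\<lambda>_. borel)) (\<lambda>x. \<lambda>k\<in>{..<p}. \<Sum>i<p. C k i * (x i - mu i)) =
       PiM {..<p} (\<lambda>_. std_normal_distribution)" (is "distr _ _ ?T = _") for mu
  proof (rule N.PiM_eqI)
    fix A :: "nat \<Rightarrow> real set" assume "\<And>i. i \<in> {..<p} \<Longrightarrow> A i \<in> sets std_normal_distribution"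
    then have A[measurable]: "A i \<in> sets borel" if "i < p" for i using that by simp
    let ?aff = "\<lambda>z. \<lambda>i\<in>{..<p}. mu i + (\<Sum>k<p. U i k * z k)"
    have AE: "Pi\<^sub>E {..<p} A \<in> sets (PiM {..<p} (\<lambda>_. borel))"
      by (intro sets_PiM_I_finite) auto
    have AE': "Pi\<^sub>E {..<p} A \<in> sets ?L"
      by (intro sets_PiM_I_finite) auto
    have T[measurable]: "?T \<in> ?L \<rightarrow>\<^sub>M PiM {..<p} (\<lambda>_. borel)"
      by (intro measurable_restrict) auto
    have T': "?T \<in> mvn p mu S \<rightarrow>\<^sub>M PiM {..<p} (\<lambda>_. borel)"
      by (intro measurable_restrict) auto
    have dens[measurable]: "mvn_density p mu S \<in> borel_measurable ?L"
      unfolding mvn_density_def by (intro measurable_bil borel_measurable_divide) auto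
    \<comment> \<open>The whitening map undoes the affine substitution, because C U = 1.\<close>
    have aff: "(\<Sum>i<p. C k i * (?aff z i - mu i)) = z k" if "k < p" for k z
    proof -
      have "(\<Sum>i<p. C k i * (?aff z i - mu i)) = (\<Sum>i<p. \<Sum>l<p. C k i * U i l * z l)"
        by (simp add: sum_distrib_left mult_ac)
      also have "\<dots> = (\<Sum>l<p. (\<Sum>i<p. C k i * U i l) * z l)"
        by (subst sum.swap) (simp add: sum_distrib_right)
      also have "\<dots> = (\<Sum>l<p. if k = l then z l else 0)"
        using that by (intro sum.cong) (auto simp: CU)
      finally show ?thesis using that by simp
    qed
    have dens_aff: "(\<Prod>i<p. U i i) * mvn_density p mu S (?aff z) = (\<Prod>k<p. std_normal_density (z k))" for z
    proof -
      have "bil p S (\<lambda>k. ?aff z k - mu k) (\<lambda>k. ?aff z k - mu k) = (\<Sum>k<p. (z k)\<^sup>2)"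
        unfolding bil using aff by (intro sum.cong) (auto simp: power2_eq_square)
      moreover have "sqrt ((2 * pi) ^ p * (\<Prod>i<p. U i i)\<^sup>2) = sqrt (2 * pi) ^ p * (\<Prod>i<p. U i i)"
        using PU by (simp add: real_sqrt_mult real_sqrt_power power_mult_distrib)
      moreover have "(\<Prod>k<p. std_normal_density (z k)) = exp (- (1 / 2) * (\<Sum>k<p. (z k)\<^sup>2)) / sqrt (2 * pi) ^ p"
        unfolding std_normal_density_def prod.distrib sum_distrib_left
        by (subst exp_sum) (simp_all add: power_one_over power_mult_distrib real_sqrt_mult)
      ultimately have "mvn_density p mu S (?aff z) = (\<Prod>k<p. std_normal_density (z k)) / (\<Prod>i<p. U i i)"
        by (simp only: mvn_density_def det divide_divide_eq_left)
      then show ?thesis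
        by (simp only: times_divide_eq_right nonzero_mult_div_cancel_left[OF less_imp_neq[OF PU, symmetric]])
    qed
    have meas: "(\<lambda>x. ennreal (mvn_density p mu S x) * indicator (Pi\<^sub>E {..<p} A) (?T x)) \<in> borel_measurable ?L"
      by (intro borel_measurable_times_ennreal measurable_compose[OF dens measurable_ennreal]
          measurable_compose[OF T] borel_measurable_indicator AE)
    have aff_meas: "?aff \<in> ?L \<rightarrow>\<^sub>M ?L"
      by (intro measurable_restrict) auto
    have "emeasure (distr (mvn p mu S) (PiM {..<p} (\<lambda>_. borel)) ?T) (Pi\<^sub>E {..<p} A) =
        emeasure (mvn p mu S) (?T -` Pi\<^sub>E {..<p} A \<inter> space ?L)"
      by (subst emeasure_distr[OF T' AE]) (simp add: mvn_def)
    also have "\<dots> = (\<integral>\<^sup>+x. ennreal (mvn_density p mu S x) * indicator (?T -` Pi\<^sub>E {..<p} A \<inter> space ?L) x \<partial>?L)"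
      unfolding mvn_def
      by (rule emeasure_density[OF measurable_compose[OF dens measurable_ennreal] measurable_sets[OF T AE]])
    also have "\<dots> = (\<integral>\<^sup>+x. ennreal (mvn_density p mu S x) * indicator (Pi\<^sub>E {..<p} A) (?T x) \<partial>?L)"
      by (rule nn_integral_cong) (simp add: indicator_def)
    also have "\<dots> = ennreal (\<Prod>i<p. U i i) *
       (\<integral>\<^sup>+z. ennreal (mvn_density p mu S (?aff z)) * indicator (Pi\<^sub>E {..<p} A) (?T (?aff z)) \<partial>?L)"
      by (rule nn_integral_PiM_lborel_upper_triangular[OF U meas])
    also have "\<dots> = (\<integral>\<^sup>+z. ennreal (\<Prod>i<p. U i i) *
       (ennreal (mvn_density p mu S (?aff z)) * indicator (Pi\<^sub>E {..<p} A) (?T (?aff z))) \<partial>?L)"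
      by (rule nn_integral_cmult[symmetric, OF measurable_compose[OF aff_meas meas]])
    also have "\<dots> = (\<integral>\<^sup>+z. (\<Prod>k<p. ennreal (std_normal_density (z k)) * indicator (A k) (z k)) \<partial>?L)"
    proof (rule nn_integral_cong)
      fix z assume z: "z \<in> space ?L"
      have ind: "indicator (Pi\<^sub>E {..<p} A) (?T (?aff z)) = (\<Prod>k<p. indicator (A k) (z k) :: ennreal)"
      proof -
        have "?T (?aff z) = (\<lambda>k\<in>{..<p}. z k)" by (intro restrict_ext aff) simp
        then show ?thesis
          by (simp only: indicator_PiE_restrict finite_lessThan)
      qed
      have "ennreal (\<Prod>i<p. U i i) * ennreal (mvn_density p mu S (?aff z)) =
         ennreal ((\<Prod>i<p. U i i) * mvn_density p mu S (?aff z))"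
        using PU by (intro ennreal_mult'[symmetric]) auto
      also have "\<dots> = (\<Prod>k<p. ennreal (std_normal_density (z k)))"
        unfolding dens_aff by (rule prod_ennreal[symmetric]) simp
      finally show "ennreal (\<Prod>i<p. U i i) *
          (ennreal (mvn_density p mu S (?aff z)) * indicator (Pi\<^sub>E {..<p} A) (?T (?aff z))) =
          (\<Prod>k<p. ennreal (std_normal_density (z k)) * indicator (A k) (z k))"
        unfolding ind prod.distrib by (simp add: mult.assoc[symmetric])
    qed
    also have "\<dots> = (\<Prod>k<p. \<integral>\<^sup>+x. ennreal (std_normal_density x) * indicator (A k) x \<partial>lborel)"
      by (rule product_nn_integral_prod) auto
    also have "\<dots> = (\<Prod>k<p. emeasure std_normal_distribution (A k))"
      by (intro prod.cong refl emeasure_density[symmetric]) auto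
    finally show "emeasure (distr (mvn p mu S) (PiM {..<p} (\<lambda>_. borel)) ?T) (Pi\<^sub>E {..<p} A) =
      (\<Prod>i<p. emeasure std_normal_distribution (A i))" .
  next
    show "sets (distr (mvn p mu S) (PiM {..<p} (\<lambda>_. borel)) ?T) = sets (PiM {..<p} (\<lambda>_. std_normal_distribution))"
      unfolding sets_distr by (rule sets_PiM_cong) simp_all
  qed simp
  with bil have "whitens p S C" unfolding whitens_def by simp
  then show ?thesis by blast
qed

section \<open>Moments of the sample means\<close>

lemma prob_space_std_normal: "prob_space std_normal_distribution"
  by (intro prob_space_normal_density) simp

lemma prob_space_mvn:
  assumes "sym_posdef p S"
  shows "prob_space (mvn p mu S)"
proof -
  obtain C where "whitens p S C"
    using mvn_whitening[OF assms] ..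
  then have distr: "distr (mvn p mu S) (PiM {..<p} (\<lambda>_. borel)) (\<lambda>x. \<lambda>k\<in>{..<p}. \<Sum>i<p. C k i * (x i - mu i)) =
       PiM {..<p} (\<lambda>_. std_normal_distribution)"
    unfolding whitens_def by simp
  have "prob_space (PiM {..<p} (\<lambda>_. std_normal_distribution))"
    by (intro prob_space_PiM prob_space_std_normal)
  moreover have "(\<lambda>x. \<lambda>k\<in>{..<p}. \<Sum>i<p. C k i * (x i - mu i)) \<in> mvn p mu S \<rightarrow>\<^sub>M PiM {..<p} (\<lambda>_. borel)"
    by (intro measurable_restrict) auto
  ultimately show ?thesis
    unfolding distr[symmetric] by (rule prob_space_distrD[rotated])
qed

text \<open>Turns independent vectors with independent coordinates into one independent family
  indexed by pairs of sample point and coordinate. The preimage of a box is a product over the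
  sample points, and each factor is again the measure of a box.\<close>

lemma distr_PiM_flatten:
  fixes T :: "'a \<Rightarrow> 'k \<Rightarrow> real" and I :: "'i set" and K :: "'k set"
  assumes \<nu>: "prob_space \<nu>" and N: "prob_space N" "sets N = sets borel"
    and T[measurable]: "T \<in> \<nu> \<rightarrow>\<^sub>M PiM K (\<lambda>_. borel)"
    and fin: "finite I" "finite K"
    and distr: "distr \<nu> (PiM K (\<lambda>_. borel)) T = PiM K (\<lambda>_. N)"
  shows "distr (PiM I (\<lambda>_. \<nu>)) (PiM (I \<times> K) (\<lambda>_. borel)) (\<lambda>X. \<lambda>i\<in>I \<times> K. T (X (fst i)) (snd i)) =
    PiM (I \<times> K) (\<lambda>_. N)" (is "distr ?P ?B ?F = _")
proof -
  interpret \<nu>: product_sigma_finite "\<lambda>_::'i. \<nu>"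
    by (simp add: product_sigma_finite_def prob_space_imp_sigma_finite \<nu>)
  interpret N: product_sigma_finite "\<lambda>_::'i \<times> 'k. N"
    by (simp add: product_sigma_finite_def prob_space_imp_sigma_finite N)
  interpret N': product_sigma_finite "\<lambda>_::'k. N"
    by (simp add: product_sigma_finite_def prob_space_imp_sigma_finite N)
  have F: "?F \<in> ?P \<rightarrow>\<^sub>M ?B"
  proof (rule measurable_restrict)
    fix i assume "i \<in> I \<times> K"
    then have i: "fst i \<in> I" "snd i \<in> K" by auto
    have "(\<lambda>X. T (X (fst i))) \<in> ?P \<rightarrow>\<^sub>M PiM K (\<lambda>_. borel)"
      by (rule measurable_compose[OF measurable_component_singleton[OF i(1)] T])
    from measurable_compose[OF this measurable_component_singleton[OF i(2)]]
    show "(\<lambda>X. T (X (fst i)) (snd i)) \<in> borel_measurable ?P" .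
  qed
  show ?thesis
  proof (rule N.PiM_eqI)
    fix A :: "'i \<times> 'k \<Rightarrow> real set" assume "\<And>i. i \<in> I \<times> K \<Longrightarrow> A i \<in> sets N"
    then have A: "A i \<in> sets borel" if "i \<in> I \<times> K" for i using that N by simp
    define B where "B t = T -` (\<Pi>\<^sub>E k\<in>K. A (t, k)) \<inter> space \<nu>" for t
    have AE: "(\<Pi>\<^sub>E k\<in>K. A (t, k)) \<in> sets (PiM K (\<lambda>_. borel))" if "t \<in> I" for t
      using A that fin by (intro sets_PiM_I_finite) auto
    have B: "B t \<in> sets \<nu>" if "t \<in> I" for t
      unfolding B_def by (rule measurable_sets[OF T AE[OF that]])
    \<comment> \<open>Membership in a \<open>Pi\<^sub>E\<close> box includes extensionality, which
      has to be matched between the joint box and its slices.\<close>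
    have T_ext: "T x \<in> extensional K" if "x \<in> space \<nu>" for x
      using measurable_space[OF T that] by (simp add: space_PiM PiE_def)
    have "emeasure (distr ?P ?B ?F) (Pi\<^sub>E (I \<times> K) A) = emeasure ?P (?F -` Pi\<^sub>E (I \<times> K) A \<inter> space ?P)"
      using A fin by (intro emeasure_distr[OF F] sets_PiM_I_finite) auto
    also have "?F -` Pi\<^sub>E (I \<times> K) A \<inter> space ?P = Pi\<^sub>E I B"
      using T_ext by (auto simp: space_PiM B_def PiE_iff)
    also have "emeasure ?P (Pi\<^sub>E I B) = (\<Prod>t\<in>I. emeasure \<nu> (B t))"
      using B fin by (intro \<nu>.emeasure_PiM) auto
    also have "\<dots> = (\<Prod>t\<in>I. \<Prod>k\<in>K. emeasure N (A (t, k)))"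
    proof (rule prod.cong[OF refl])
      fix t assume t: "t \<in> I"
      have "emeasure \<nu> (B t) = emeasure (PiM K (\<lambda>_. N)) (\<Pi>\<^sub>E k\<in>K. A (t, k))"
        unfolding distr[symmetric] B_def by (rule emeasure_distr[OF T AE[OF t], symmetric])
      also have "\<dots> = (\<Prod>k\<in>K. emeasure N (A (t, k)))"
        using A t fin N(2) by (intro N'.emeasure_PiM) auto
      finally show "emeasure \<nu> (B t) = (\<Prod>k\<in>K. emeasure N (A (t, k)))" .
    qed
    also have "\<dots> = (\<Prod>i\<in>I \<times> K. emeasure N (A i))"
      by (simp add: prod.cartesian_product)
    finally show "emeasure (distr ?P ?B ?F) (Pi\<^sub>E (I \<times> K) A) = (\<Prod>i\<in>I \<times> K. emeasure N (A i))" .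
  next
    show "sets (distr ?P ?B ?F) = sets (PiM (I \<times> K) (\<lambda>_. N))"
      unfolding sets_distr by (rule sets_PiM_cong) (simp_all add: N)
  qed (use fin in simp)
qed

text \<open>Independence is read off from the joint law being the product of the marginal laws. That
  criterion asks for a nonempty index set, hence \<open>p > 0\<close> and
  \<open>n > 0\<close>.\<close>

lemma whitened_sample_indep:
  fixes mu :: rvec and n :: nat
  assumes S: "sym_posdef p S" and C: "whitens p S C" and "p > 0" "n > 0"
  defines "P \<equiv> PiM {..<n} (\<lambda>_. mvn p mu S)"
    and "\<xi> \<equiv> (\<lambda>i X. \<Sum>j<p. C (snd i) j * (X (fst i) j - mu j))"
  shows "prob_space.indep_vars P (\<lambda>_. borel) \<xi> ({..<n} \<times> {..<p})"
    and "i \<in> {..<n} \<times> {..<p} \<Longrightarrow> distributed P lborel (\<xi> i) std_normal_density"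
proof -
  interpret P: prob_space P unfolding P_def by (intro prob_space_PiM prob_space_mvn[OF S])
  let ?I = "{..<n} \<times> {..<p}"
  let ?N = std_normal_distribution
  let ?T = "\<lambda>x. \<lambda>k\<in>{..<p}. \<Sum>i<p. C k i * (x i - mu i)"
  have T: "?T \<in> mvn p mu S \<rightarrow>\<^sub>M PiM {..<p} (\<lambda>_. borel)"
    by (intro measurable_restrict) auto
  have "distr P (PiM ?I (\<lambda>_. borel)) (\<lambda>X. \<lambda>i\<in>?I. ?T (X (fst i)) (snd i)) = PiM ?I (\<lambda>_. ?N)"
    unfolding P_def
    by (rule distr_PiM_flatten[OF prob_space_mvn[OF S] prob_space_std_normal _ T])
       (use C in \<open>simp_all add: whitens_def\<close>)
  also have "(\<lambda>X. \<lambda>i\<in>?I. ?T (X (fst i)) (snd i)) = (\<lambda>X. \<lambda>i\<in>?I. \<xi> i X)"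
    by (auto simp: \<xi>_def fun_eq_iff restrict_def)
  finally have distr: "distr P (PiM ?I (\<lambda>_. borel)) (\<lambda>X. \<lambda>i\<in>?I. \<xi> i X) = PiM ?I (\<lambda>_. ?N)" .
  have \<xi>: "\<xi> i \<in> borel_measurable P" if "i \<in> ?I" for i
  proof -
    have "(\<lambda>X. X (fst i) j) \<in> borel_measurable P" if "j < p" for j
    proof -
      have "(\<lambda>X. X (fst i)) \<in> P \<rightarrow>\<^sub>M mvn p mu S"
        unfolding P_def using \<open>i \<in> ?I\<close> by (intro measurable_component_singleton) auto
      moreover have "(\<lambda>x. x j) \<in> borel_measurable (mvn p mu S)"
        using that by (subst measurable_cong_sets[OF sets_mvn refl], intro measurable_component_singleton) simp
      ultimately show ?thesis by (rule measurable_compose)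
    qed
    then show ?thesis unfolding \<xi>_def by (intro borel_measurable_sum borel_measurable_times) auto
  qed
  have comp: "distr P borel (\<xi> i) = ?N" if "i \<in> ?I" for i
  proof -
    have "distr P borel (\<xi> i) = distr (distr P (PiM ?I (\<lambda>_. borel)) (\<lambda>X. \<lambda>i\<in>?I. \<xi> i X)) borel (\<lambda>\<omega>. \<omega> i)"
      using that by (subst distr_distr) (auto intro!: measurable_restrict \<xi> simp: comp_def)
    also have "\<dots> = distr (PiM ?I (\<lambda>_. ?N)) ?N (\<lambda>\<omega>. \<omega> i)"
      unfolding distr by (rule distr_cong) auto
    also have "\<dots> = ?N"
      using that prob_space_std_normal by (intro distr_PiM_component) auto
    finally show ?thesis .
  qed
  have "?I \<noteq> {}" using \<open>p > 0\<close> \<open>n > 0\<close> by auto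
  then show "P.indep_vars (\<lambda>_. borel) \<xi> ?I"
    by (subst P.indep_vars_iff_distr_eq_PiM') (auto simp: \<xi> distr comp intro!: PiM_cong)
  show "distributed P lborel (\<xi> i) std_normal_density" if "i \<in> ?I" for i
    using comp[OF that] \<xi>[OF that] by (auto simp: distributed_def cong: distr_cong)
qed


definition white_err :: "nat \<Rightarrow> rmat \<Rightarrow> rvec \<Rightarrow> nat \<Rightarrow> nat \<Rightarrow> (nat \<Rightarrow> rvec) \<Rightarrow> real" where
  "white_err p C mu n k X = (\<Sum>j<p. C k j * (smean p n X j - mu j))"

text \<open>Coordinate \<open>k\<close> averages the standard normals over the column
  \<open>{..<n} \<times> {k}\<close>. Distinct coordinates use disjoint columns, hence independence;
  the standard deviation is sqrt n / n.\<close>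

lemma whitened_smean_normal:
  fixes mu :: rvec and n :: nat
  assumes S: "sym_posdef p S" and C: "whitens p S C" and n: "n > 0"
  defines "P \<equiv> PiM {..<n} (\<lambda>_. mvn p mu S)"
    and "W \<equiv> white_err p C mu n"
  shows "k < p \<Longrightarrow> distributed P lborel (W k) (normal_density 0 (1 / sqrt n))"
    and "k < p \<Longrightarrow> l < p \<Longrightarrow> k \<noteq> l \<Longrightarrow> prob_space.indep_var P borel (W k) borel (W l)"
proof -
  interpret P: prob_space P unfolding P_def by (intro prob_space_PiM prob_space_mvn[OF S])
  define \<xi> :: "nat \<times> nat \<Rightarrow> (nat \<Rightarrow> rvec) \<Rightarrow> real" where "\<xi> = (\<lambda>i X. \<Sum>j<p. C (snd i) j * (X (fst i) j - mu j))"
  have indep: "P.indep_vars (\<lambda>_. borel) \<xi> ({..<n} \<times> {..<p})" if "p > 0"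
    using whitened_sample_indep(1)[OF S C that n] unfolding P_def \<xi>_def .
  have normal: "distributed P lborel (\<xi> i) std_normal_density" if "p > 0" "i \<in> {..<n} \<times> {..<p}" for i
    using whitened_sample_indep(2)[OF S C that(1) n that(2)] unfolding P_def \<xi>_def .
  have W: "W k X = (\<Sum>i\<in>{..<n} \<times> {k}. \<xi> i X) / n" for k X
  proof -
    have "smean p n X j - mu j = (\<Sum>t<n. X t j - mu j) / n" if "j < p" for j
      using n that by (simp add: smean_def sum_subtractf field_simps)
    then have "W k X = (\<Sum>j<p. C k j * ((\<Sum>t<n. X t j - mu j) / n))"
      unfolding W_def white_err_def by simp
    also have "\<dots> = (\<Sum>j<p. \<Sum>t<n. C k j * (X t j - mu j)) / n"
      by (simp add: sum_distrib_left sum_divide_distrib)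
    also have "\<dots> = (\<Sum>t<n. \<Sum>j<p. C k j * (X t j - mu j)) / n"
      by (subst sum.swap) simp
    also have "\<dots> = (\<Sum>i\<in>{..<n} \<times> {k}. \<xi> i X) / n"
    proof -
      have "(\<Sum>i\<in>{..<n} \<times> {k}. \<xi> i X) = (\<Sum>t<n. \<Sum>k'\<in>{k}. \<xi> (t, k') X)"
        unfolding sum.cartesian_product by (intro sum.cong) auto
      then show ?thesis by (simp add: \<xi>_def)
    qed
    finally show ?thesis .
  qed
  show "distributed P lborel (W k) (normal_density 0 (1 / sqrt n))" if "k < p"
  proof -
    have "distributed P lborel (\<lambda>X. \<Sum>i\<in>{..<n} \<times> {k}. \<xi> i X)
       (normal_density (\<Sum>i\<in>{..<n} \<times> {k}. 0) (sqrt (\<Sum>i\<in>{..<n} \<times> {k}. 1\<^sup>2)))"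
      using that n
      by (intro P.sum_indep_normal normal P.indep_vars_subset[OF indep]) auto
    then have "distributed P lborel (\<lambda>X. \<Sum>i\<in>{..<n} \<times> {k}. \<xi> i X) (normal_density 0 (sqrt n))"
      by (simp add: card_cartesian_product)
    from P.normal_density_affine[OF this, of "1 / n" 0]
    have "distributed P lborel (W k) (normal_density 0 (1 / n * sqrt n))"
      using n by (simp add: W[abs_def])
    moreover have "1 / n * sqrt n = 1 / sqrt n"
      using n by (simp add: field_simps)
    ultimately show ?thesis by simp
  qed
  show "P.indep_var borel (W k) borel (W l)" if "k < p" "l < p" "k \<noteq> l"
  proof -
    have "p > 0" using that by simp
    let ?A = "\<lambda>k. {..<n} \<times> {k}"
    have "P.indep_var (PiM (?A k) (\<lambda>_. borel)) (\<lambda>\<omega>. restrict (\<lambda>i. \<xi> i \<omega>) (?A k))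
        (PiM (?A l) (\<lambda>_. borel)) (\<lambda>\<omega>. restrict (\<lambda>i. \<xi> i \<omega>) (?A l))"
      using that by (intro P.indep_var_restrict[OF indep[OF \<open>p > 0\<close>]]) auto
    then have "P.indep_var borel ((\<lambda>f. (\<Sum>i\<in>?A k. f i) / n) \<circ> (\<lambda>\<omega>. restrict (\<lambda>i. \<xi> i \<omega>) (?A k)))
        borel ((\<lambda>f. (\<Sum>i\<in>?A l. f i) / n) \<circ> (\<lambda>\<omega>. restrict (\<lambda>i. \<xi> i \<omega>) (?A l)))"
      by (rule P.indep_var_compose)
         (intro borel_measurable_divide borel_measurable_sum measurable_component_singleton, auto)+
    moreover have "(\<lambda>f. (\<Sum>i\<in>?A k. f i) / n) \<circ> (\<lambda>\<omega>. restrict (\<lambda>i. \<xi> i \<omega>) (?A k)) = W k" for k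
      by (simp add: fun_eq_iff W)
    ultimately show ?thesis by simp
  qed
qed

text \<open>The fourth moment is the case k = 2 of (2k)! \<sigma>^(2k) / (2^k k!); it supplies the
  variance of a squared coordinate.\<close>

lemma (in prob_space) normal_moments:
  assumes Z: "distributed M lborel Z (normal_density 0 \<sigma>)" and \<sigma>: "\<sigma> > 0"
  shows "integrable M (\<lambda>x. Z x ^ j)"
    and "expectation Z = 0" "expectation (\<lambda>x. Z x ^ 2) = \<sigma>\<^sup>2" "expectation (\<lambda>x. Z x ^ 4) = 3 * \<sigma> ^ 4"
proof -
  show "integrable M (\<lambda>x. Z x ^ j)"
    using integrable_normal_moment[OF \<sigma>, of 0 j]
    by (subst distributed_integrable[OF Z, symmetric]) auto
  have E: "expectation (\<lambda>x. Z x ^ j) = (\<integral>x. normal_density 0 \<sigma> x * x ^ j \<partial>lborel)" for j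
    by (rule distributed_integral[OF Z, symmetric]) auto
  show "expectation Z = 0"
    using E[of 1] integral_normal_moment_odd[OF \<sigma>, of 0 0] by simp
  show "expectation (\<lambda>x. Z x ^ 2) = \<sigma>\<^sup>2"
    using E[of 2] integral_normal_moment_even[OF \<sigma>, of 0 1] by (simp add: power2_eq_square)
  show "expectation (\<lambda>x. Z x ^ 4) = 3 * \<sigma> ^ 4"
    using E[of 4] integral_normal_moment_even[OF \<sigma>, of 0 2] by (simp add: fact_numeral power_divide)
qed

text \<open>Pythagoras in L2. It is applied to the linear terms, to the centred squares and to the
  products across classes; in each case the \<open>p\<^sup>2\<close> mixed moments collapse to
  \<open>p\<close> diagonal ones, and this order is what makes the second moments vanish in the
  limit.\<close>

lemma integral_square_sum_orthogonal:
  fixes Z :: "'k \<Rightarrow> 'a \<Rightarrow> real"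
  assumes "finite K"
    and int: "\<And>k l. k \<in> K \<Longrightarrow> l \<in> K \<Longrightarrow> integrable M (\<lambda>x. Z k x * Z l x)"
    and orth: "\<And>k l. k \<in> K \<Longrightarrow> l \<in> K \<Longrightarrow> k \<noteq> l \<Longrightarrow> (\<integral>x. Z k x * Z l x \<partial>M) = 0"
  shows "integrable M (\<lambda>x. (\<Sum>k\<in>K. Z k x)\<^sup>2)"
    and "(\<integral>x. (\<Sum>k\<in>K. Z k x)\<^sup>2 \<partial>M) = (\<Sum>k\<in>K. \<integral>x. (Z k x)\<^sup>2 \<partial>M)"
proof -
  have sq: "(\<Sum>k\<in>K. Z k x)\<^sup>2 = (\<Sum>k\<in>K. \<Sum>l\<in>K. Z k x * Z l x)" for x
    by (simp add: power2_eq_square sum_product)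
  show "integrable M (\<lambda>x. (\<Sum>k\<in>K. Z k x)\<^sup>2)"
    unfolding sq by (intro Bochner_Integration.integrable_sum int)
  have "(\<integral>x. (\<Sum>k\<in>K. Z k x)\<^sup>2 \<partial>M) = (\<Sum>k\<in>K. \<Sum>l\<in>K. \<integral>x. Z k x * Z l x \<partial>M)"
    unfolding sq
    by (subst Bochner_Integration.integral_sum, intro Bochner_Integration.integrable_sum int, assumption+)
       (intro sum.cong refl Bochner_Integration.integral_sum int)
  also have "\<dots> = (\<Sum>k\<in>K. \<Sum>l\<in>K. if k = l then \<integral>x. (Z k x)\<^sup>2 \<partial>M else 0)"
    using orth by (intro sum.cong refl) (auto simp: power2_eq_square)
  also have "\<dots> = (\<Sum>k\<in>K. \<integral>x. (Z k x)\<^sup>2 \<partial>M)"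
    using \<open>finite K\<close> by simp
  finally show "(\<integral>x. (\<Sum>k\<in>K. Z k x)\<^sup>2 \<partial>M) = (\<Sum>k\<in>K. \<integral>x. (Z k x)\<^sup>2 \<partial>M)" .
qed

text \<open>Fubini for a product of one-sided functions; with one factor equal to 1 it also gives
  the marginals of \<open>sample_meas\<close>.\<close>

lemma (in pair_prob_space) integral_times_fst_snd:
  fixes f :: "'a \<Rightarrow> real" and g :: "'b \<Rightarrow> real"
  assumes f: "integrable M1 f" and g: "integrable M2 g"
  shows "integrable (M1 \<Otimes>\<^sub>M M2) (\<lambda>z. f (fst z) * g (snd z))"
    and "(\<integral>z. f (fst z) * g (snd z) \<partial>(M1 \<Otimes>\<^sub>M M2)) = (\<integral>x. f x \<partial>M1) * (\<integral>y. g y \<partial>M2)"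
proof -
  note [measurable] = borel_measurable_integrable[OF f] borel_measurable_integrable[OF g]
  show int: "integrable (M1 \<Otimes>\<^sub>M M2) (\<lambda>z. f (fst z) * g (snd z))"
    using f g by (intro Fubini_integrable) (auto simp: abs_mult)
  show "(\<integral>z. f (fst z) * g (snd z) \<partial>(M1 \<Otimes>\<^sub>M M2)) = (\<integral>x. f x \<partial>M1) * (\<integral>y. g y \<partial>M2)"
    using integral_fst'[OF int] by simp
qed

lemma (in prob_space) indep_var_product_moment:
  fixes X Y :: "'a \<Rightarrow> real"
  assumes "indep_var borel X borel Y" "integrable M X" "integrable M Y" "expectation X = 0"
  shows "integrable M (\<lambda>x. X x * Y x)" "expectation (\<lambda>x. X x * Y x) = 0"
  using indep_var_integrable[OF assms(1-3)] indep_var_lebesgue_integral[OF assms(1-3)] assms(4)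
  by simp_all

text \<open>Off the diagonal, independence and centring give 0. On the diagonal, the variance of a
  squared coordinate is 3/n^2 - 1/n^2 = 2/n^2.\<close>

lemma whitened_smean_moments:
  fixes mu :: rvec and n :: nat
  assumes S: "sym_posdef p S" and C: "whitens p S C" and n: "n > 0" and k: "k < p" and l: "l < p"
  defines "P \<equiv> PiM {..<n} (\<lambda>_. mvn p mu S)"
    and "W \<equiv> white_err p C mu n"
  shows "integrable P (\<lambda>X. W k X * W l X)"
    and "(\<integral>X. W k X * W l X \<partial>P) = (if k = l then 1 / n else 0)"
    and "integrable P (\<lambda>X. ((W k X)\<^sup>2 - 1 / n) * ((W l X)\<^sup>2 - 1 / n))"
    and "(\<integral>X. ((W k X)\<^sup>2 - 1 / n) * ((W l X)\<^sup>2 - 1 / n) \<partial>P) = (if k = l then 2 / n\<^sup>2 else 0)"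
proof -
  interpret P: prob_space P unfolding P_def by (intro prob_space_PiM prob_space_mvn[OF S])
  have normal: "distributed P lborel (W k) (normal_density 0 (1 / sqrt n))" if "k < p" for k
    using whitened_smean_normal(1)[OF S C n that] unfolding P_def W_def .
  have \<sigma>: "1 / sqrt n > 0" using n by simp
  have int[simp]: "integrable P (\<lambda>X. W k X ^ j)" if "k < p" for k j
    using P.normal_moments(1)[OF normal[OF that] \<sigma>] .
  have int1: "integrable P (W k)" if "k < p" for k
    using int[OF that, of 1] by simp
  have int2: "integrable P (\<lambda>X. (W k X)\<^sup>2 - 1 / n)" if "k < p" for k
    using that by (intro Bochner_Integration.integrable_diff int) auto
  have E1: "P.expectation (W k) = 0" if "k < p" for k
    using P.normal_moments(2)[OF normal[OF that] \<sigma>] .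
  have E2: "P.expectation (\<lambda>X. W k X ^ 2) = 1 / n" if "k < p" for k
    using P.normal_moments(3)[OF normal[OF that] \<sigma>] by (simp add: power_divide)
  have E4: "P.expectation (\<lambda>X. W k X ^ 4) = 3 / n\<^sup>2" if "k < p" for k
  proof -
    have "sqrt n ^ 4 = (real n)\<^sup>2"
      using power_mult[of "sqrt n" 2 2] by simp
    then show ?thesis
      using P.normal_moments(4)[OF normal[OF that] \<sigma>] by (simp add: power_divide)
  qed
  have E2': "P.expectation (\<lambda>X. (W k X)\<^sup>2 - 1 / n) = 0" if "k < p" for k
    using that by (subst Bochner_Integration.integral_diff) (simp_all add: E2 P.prob_space)
  have sq: "((W k X)\<^sup>2 - 1 / n)\<^sup>2 = W k X ^ 4 - 2 / n * (W k X)\<^sup>2 + 1 / n\<^sup>2" for X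
    by (simp add: power2_diff power_divide mult_ac flip: power_mult)
  have "integrable P (\<lambda>X. ((W k X)\<^sup>2 - 1 / n)\<^sup>2)"
    unfolding sq using k by (intro Bochner_Integration.integrable_add Bochner_Integration.integrable_diff
        integrable_mult_right int) auto
  moreover have "P.expectation (\<lambda>X. ((W k X)\<^sup>2 - 1 / n)\<^sup>2) = 2 / n\<^sup>2"
  proof -
    have "P.expectation (\<lambda>X. W k X ^ 4 - 2 / n * (W k X)\<^sup>2 + 1 / n\<^sup>2) = 3 / n\<^sup>2 - 2 / n * (1 / n) + 1 / n\<^sup>2"
      using k E2[OF k] E4[OF k] by (simp add: P.prob_space)
    then show ?thesis
      unfolding sq by (simp add: power2_eq_square)
  qed
  moreover have indep: "P.indep_var borel (W k) borel (W l)" if "k \<noteq> l"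
    using whitened_smean_normal(2)[OF S C n k l that] unfolding P_def W_def .
  moreover have indep2: "P.indep_var borel (\<lambda>X. (W k X)\<^sup>2 - 1 / n) borel (\<lambda>X. (W l X)\<^sup>2 - 1 / n)" if "k \<noteq> l"
    using P.indep_var_compose[OF indep[OF that], of "\<lambda>x. x\<^sup>2 - 1 / n" borel "\<lambda>x. x\<^sup>2 - 1 / n" borel]
    by (simp add: comp_def)
  ultimately show "integrable P (\<lambda>X. W k X * W l X)"
    and "(\<integral>X. W k X * W l X \<partial>P) = (if k = l then 1 / n else 0)"
    and "integrable P (\<lambda>X. ((W k X)\<^sup>2 - 1 / n) * ((W l X)\<^sup>2 - 1 / n))"
    and "(\<integral>X. ((W k X)\<^sup>2 - 1 / n) * ((W l X)\<^sup>2 - 1 / n) \<partial>P) = (if k = l then 2 / n\<^sup>2 else 0)"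
    using P.indep_var_product_moment[OF indep int1[OF k] int1[OF l] E1[OF k]]
      P.indep_var_product_moment[OF indep2 int2[OF k] int2[OF l] E2'[OF k]]
      int[OF k, of 2] E2[OF k]
    by (cases "k = l"; simp add: power2_eq_square)+
qed

text \<open>In whitened coordinates the linear functional has coefficient vector C v, whose squared
  length is \<open>bil p S v v\<close>; the quadratic one is a sum of \<open>p\<close> squares, each
  with mean 1/n.\<close>

lemma bil_smean_moments:
  fixes mu :: rvec and n :: nat
  assumes S: "sym_posdef p S" and n: "n > 0"
  defines "P \<equiv> PiM {..<n} (\<lambda>_. mvn p mu S)"
    and "e \<equiv> (\<lambda>X j. smean p n X j - mu j)"
  shows "integrable P (\<lambda>X. (bil p S v (e X))\<^sup>2)"
    and "(\<integral>X. (bil p S v (e X))\<^sup>2 \<partial>P) = bil p S v v / real n"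
    and "integrable P (\<lambda>X. (bil p S (e X) (e X) - real p / real n)\<^sup>2)"
    and "(\<integral>X. (bil p S (e X) (e X) - real p / real n)\<^sup>2 \<partial>P) = 2 * real p / (real n)\<^sup>2"
proof -
  obtain C where C: "whitens p S C"
    using mvn_whitening[OF S] ..
  define W where "W = white_err p C mu n"
  define c where "c = (\<lambda>k. \<Sum>i<p. C k i * v i)"
  note moments = whitened_smean_moments[OF S C n, of _ _ mu, folded P_def, folded W_def]
  have bil: "bil p S a b = (\<Sum>k<p. (\<Sum>i<p. C k i * a i) * (\<Sum>i<p. C k i * b i))" for a b
    using C unfolding whitens_def by simp
  have lin: "bil p S v (e X) = (\<Sum>k<p. c k * W k X)" for X
    unfolding bil c_def W_def white_err_def e_def ..
  have int: "integrable P (\<lambda>X. (c k * W k X) * (c l * W l X))" if "k < p" "l < p" for k l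
    using integrable_mult_right[OF moments(1)[OF that], of "c k * c l"] by (simp add: mult_ac)
  have E: "(\<integral>X. (c k * W k X) * (c l * W l X) \<partial>P) = c k * c l * (if k = l then 1 / n else 0)"
    if "k < p" "l < p" for k l
  proof -
    have "(\<integral>X. (c k * W k X) * (c l * W l X) \<partial>P) = (\<integral>X. c k * c l * (W k X * W l X) \<partial>P)"
      by (simp add: mult_ac)
    then show ?thesis by (simp add: moments(2)[OF that])
  qed
  show "integrable P (\<lambda>X. (bil p S v (e X))\<^sup>2)"
    unfolding lin using int E by (intro integral_square_sum_orthogonal) auto
  have "(\<integral>X. (bil p S v (e X))\<^sup>2 \<partial>P) = (\<Sum>k<p. \<integral>X. (c k * W k X)\<^sup>2 \<partial>P)"
    unfolding lin using int E by (intro integral_square_sum_orthogonal) auto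
  also have "\<dots> = (\<Sum>k<p. c k * c k * (1 / n))"
    using E by (intro sum.cong refl) (simp add: power2_eq_square)
  finally show "(\<integral>X. (bil p S v (e X))\<^sup>2 \<partial>P) = bil p S v v / real n"
    by (simp add: bil c_def sum_divide_distrib)
  have quad: "bil p S (e X) (e X) - real p / real n = (\<Sum>k<p. (W k X)\<^sup>2 - 1 / n)" for X
    unfolding bil W_def white_err_def e_def by (simp add: sum_subtractf power2_eq_square)
  show "integrable P (\<lambda>X. (bil p S (e X) (e X) - real p / real n)\<^sup>2)"
    unfolding quad using moments(3,4) by (intro integral_square_sum_orthogonal) auto
  have "(\<integral>X. (bil p S (e X) (e X) - real p / real n)\<^sup>2 \<partial>P) = (\<Sum>k<p. \<integral>X. ((W k X)\<^sup>2 - 1 / n)\<^sup>2 \<partial>P)"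
    unfolding quad using moments(3,4) by (intro integral_square_sum_orthogonal) auto
  also have "\<dots> = (\<Sum>k<p. 2 / (real n)\<^sup>2)"
    using moments(4) by (intro sum.cong refl) (simp add: power2_eq_square)
  finally show "(\<integral>X. (bil p S (e X) (e X) - real p / real n)\<^sup>2 \<partial>P) = 2 * real p / (real n)\<^sup>2"
    by simp
qed

text \<open>The common covariance lets one \<open>C\<close> whiten both errors, so the mixed moments
  factor over the two samples and leave 1/(n0 n1) for each of the \<open>p\<close>
  coordinates.\<close>

lemma bil_smean_cross_moment:
  fixes mu0 mu1 :: rvec and n0 n1 :: nat
  assumes S: "sym_posdef p S" and n: "n0 > 0" "n1 > 0"
  defines "M \<equiv> sample_meas p S mu0 mu1 n0 n1"
    and "b \<equiv> (\<lambda>X. bil p S (\<lambda>j. smean p n0 (fst X) j - mu0 j) (\<lambda>j. smean p n1 (snd X) j - mu1 j))"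
  shows "integrable M (\<lambda>X. (b X)\<^sup>2)" and "(\<integral>X. (b X)\<^sup>2 \<partial>M) = p / (real n0 * real n1)"
proof -
  let ?P = "\<lambda>n mu. PiM {..<n} (\<lambda>_. mvn p mu S)"
  have prob: "prob_space (?P n mu)" for n :: nat and mu
    by (intro prob_space_PiM prob_space_mvn[OF S])
  interpret P: pair_prob_space "?P n0 mu0" "?P n1 mu1"
    using prob[of n0 mu0] prob[of n1 mu1]
    by (simp add: pair_prob_space_def pair_sigma_finite_def prob_space_imp_sigma_finite)
  obtain C where C: "whitens p S C"
    using mvn_whitening[OF S] ..
  define W where "W = (\<lambda>n mu. white_err p C mu n)"
  have moments: "integrable (?P n mu) (\<lambda>X. W n mu k X * W n mu l X)"
    "(\<integral>X. W n mu k X * W n mu l X \<partial>?P n mu) = (if k = l then 1 / n else 0)"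
    if "n > 0" "k < p" "l < p" for n :: nat and mu k l
    using whitened_smean_moments(1,2)[OF S C that, of mu] unfolding W_def .
  have b: "b X = (\<Sum>k<p. W n0 mu0 k (fst X) * W n1 mu1 k (snd X))" for X
    using C unfolding whitens_def b_def W_def white_err_def by simp
  have M: "M = ?P n0 mu0 \<Otimes>\<^sub>M ?P n1 mu1"
    unfolding M_def sample_meas_def ..
  have mult: "(W n0 mu0 k (fst X) * W n1 mu1 k (snd X)) * (W n0 mu0 l (fst X) * W n1 mu1 l (snd X)) =
    (W n0 mu0 k (fst X) * W n0 mu0 l (fst X)) * (W n1 mu1 k (snd X) * W n1 mu1 l (snd X))" for k l X
    by (simp add: mult_ac)
  have int: "integrable M (\<lambda>X. (W n0 mu0 k (fst X) * W n1 mu1 k (snd X)) * (W n0 mu0 l (fst X) * W n1 mu1 l (snd X)))"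
    if "k < p" "l < p" for k l
    unfolding M mult
    by (rule P.integral_times_fst_snd[OF moments(1)[OF n(1) that] moments(1)[OF n(2) that]])
  have E: "(\<integral>X. (W n0 mu0 k (fst X) * W n1 mu1 k (snd X)) * (W n0 mu0 l (fst X) * W n1 mu1 l (snd X)) \<partial>M) =
     (if k = l then 1 / (real n0 * real n1) else 0)"
    if "k < p" "l < p" for k l
    unfolding M mult
    using P.integral_times_fst_snd(2)[OF moments(1)[OF n(1) that] moments(1)[OF n(2) that]]
    by (simp add: moments(2)[OF n(1) that] moments(2)[OF n(2) that])
  show "integrable M (\<lambda>X. (b X)\<^sup>2)"
    unfolding b using int E by (intro integral_square_sum_orthogonal) auto
  have "(\<integral>X. (b X)\<^sup>2 \<partial>M) = (\<Sum>k<p. \<integral>X. (W n0 mu0 k (fst X) * W n1 mu1 k (snd X))\<^sup>2 \<partial>M)"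
    unfolding b using int E by (intro integral_square_sum_orthogonal) auto
  also have "\<dots> = (\<Sum>k<p. 1 / (real n0 * real n1))"
    using E by (intro sum.cong refl) (simp add: power2_eq_square)
  finally show "(\<integral>X. (b X)\<^sup>2 \<partial>M) = p / (real n0 * real n1)" by simp
qed

section \<open>Convergence in probability\<close>

text \<open>The measure varies with p, as each dimension has its own sample law, and the limit is a
  constant. Measurability is built in so that the closure rules propagate it.\<close>

definition tendsto_prob :: "(nat \<Rightarrow> 'a measure) \<Rightarrow> (nat \<Rightarrow> 'a \<Rightarrow> real) \<Rightarrow> real \<Rightarrow> bool" where
  "tendsto_prob M f L \<longleftrightarrow> (\<forall>p. f p \<in> borel_measurable (M p)) \<and>
    (\<forall>e>0. (\<lambda>p. measure (M p) {x \<in> space (M p). e \<le> \<bar>f p x - L\<bar>}) \<longlonglongrightarrow> 0)"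

lemma tendsto_prob_const:
  assumes "c \<longlonglongrightarrow> L"
  shows "tendsto_prob M (\<lambda>p _. c p) L"
  unfolding tendsto_prob_def
proof (intro conjI allI impI)
  fix e :: real assume "e > 0"
  with assms have "\<forall>\<^sub>F p in sequentially. dist (c p) L < e"
    by (rule tendstoD)
  then have "\<forall>\<^sub>F p in sequentially. measure (M p) {x \<in> space (M p). e \<le> \<bar>c p - L\<bar>} = 0"
    by eventually_elim (simp add: dist_real_def not_le)
  then show "(\<lambda>p. measure (M p) {x \<in> space (M p). e \<le> \<bar>c p - L\<bar>}) \<longlonglongrightarrow> 0"
    by (rule tendsto_eventually)
qed simp

text \<open>Chebyshev's inequality. The moment formula is asked for only eventually, because the
  sample size may be 0 for finitely many p.\<close>

lemma tendsto_prob_square_mean: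
  assumes M: "\<And>p. prob_space (M p)"
    and meas: "\<And>p. f p \<in> borel_measurable (M p)"
    and sq: "\<forall>\<^sub>F p in sequentially. integrable (M p) (\<lambda>x. (f p x)\<^sup>2) \<and> (\<integral>x. (f p x)\<^sup>2 \<partial>M p) = b p"
    and b: "b \<longlonglongrightarrow> 0"
  shows "tendsto_prob M f 0"
  unfolding tendsto_prob_def
proof (intro conjI allI impI)
  fix e :: real assume "e > 0"
  have "\<forall>\<^sub>F p in sequentially. measure (M p) {x \<in> space (M p). e \<le> \<bar>f p x - 0\<bar>} \<le> b p / e\<^sup>2"
    using sq
  proof eventually_elim
    case (elim p)
    interpret prob_space "M p" by (rule M)
    show ?case
      using second_moment_method[OF meas _ \<open>e > 0\<close>] elim by simp
  qed
  moreover have "(\<lambda>p. b p / e\<^sup>2) \<longlonglongrightarrow> 0"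
    using tendsto_divide[OF b tendsto_const[of "e\<^sup>2"]] \<open>e > 0\<close> by simp
  ultimately show "(\<lambda>p. measure (M p) {x \<in> space (M p). e \<le> \<bar>f p x - 0\<bar>}) \<longlonglongrightarrow> 0"
    by (rule tendsto_sandwich[OF _ _ tendsto_const, rotated]) simp
qed (rule meas)

text \<open>Continuity at the limit point alone is enough: outside two events of vanishing
  probability the pair lies within \<open>d\<close> of \<open>(L, K)\<close>. This admits division
  whenever the limit of the denominator is nonzero.\<close>

lemma tendsto_prob_continuous:
  fixes h :: "real \<times> real \<Rightarrow> real"
  assumes M: "\<And>p. prob_space (M p)"
    and f: "tendsto_prob M f L" and g: "tendsto_prob M g K"
    and h: "h \<in> borel_measurable (borel \<Otimes>\<^sub>M borel)" and cont: "isCont h (L, K)"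
  shows "tendsto_prob M (\<lambda>p x. h (f p x, g p x)) (h (L, K))"
  unfolding tendsto_prob_def
proof (intro conjI allI impI)
  have meas: "f p \<in> borel_measurable (M p)" "g p \<in> borel_measurable (M p)" for p
    using f g unfolding tendsto_prob_def by auto
  show meas_h: "(\<lambda>x. h (f p x, g p x)) \<in> borel_measurable (M p)" for p
    by (rule measurable_compose[OF measurable_Pair[OF meas] h])
  fix e :: real assume "e > 0"
  with cont obtain d where d: "d > 0" "\<And>z. dist z (L, K) < d \<Longrightarrow> dist (h z) (h (L, K)) < e"
    unfolding continuous_at_eps_delta by blast
  let ?A = "\<lambda>p. {x \<in> space (M p). d / 2 \<le> \<bar>f p x - L\<bar>}"
  let ?B = "\<lambda>p. {x \<in> space (M p). d / 2 \<le> \<bar>g p x - K\<bar>}"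
  let ?C = "\<lambda>p. {x \<in> space (M p). e \<le> \<bar>h (f p x, g p x) - h (L, K)\<bar>}"
  have le: "measure (M p) (?C p) \<le> measure (M p) (?A p) + measure (M p) (?B p)" for p
  proof -
    interpret prob_space "M p" by (rule M)
    note [measurable] = meas[of p]
    have "?C p \<subseteq> ?A p \<union> ?B p"
    proof
      fix x assume x: "x \<in> ?C p"
      have "dist (f p x, g p x) (L, K) \<le> \<bar>f p x - L\<bar> + \<bar>g p x - K\<bar>"
        unfolding dist_Pair_Pair dist_real_def by (rule order_trans[OF sqrt_sum_squares_le_sum_abs]) simp
      moreover have "\<not> dist (f p x, g p x) (L, K) < d"
        using d(2)[of "(f p x, g p x)"] x by (auto simp: dist_real_def)
      ultimately have "d / 2 \<le> \<bar>f p x - L\<bar> \<or> d / 2 \<le> \<bar>g p x - K\<bar>"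
        by linarith
      then show "x \<in> ?A p \<union> ?B p" using x by auto
    qed
    then have "measure (M p) (?C p) \<le> measure (M p) (?A p \<union> ?B p)"
      by (intro finite_measure_mono) measurable
    also have "\<dots> \<le> measure (M p) (?A p) + measure (M p) (?B p)"
      by (intro measure_Un_le) measurable
    finally show ?thesis .
  qed
  have lim: "(\<lambda>p. measure (M p) (?A p) + measure (M p) (?B p)) \<longlonglongrightarrow> 0"
  proof (rule tendsto_add_zero)
    show "(\<lambda>p. measure (M p) (?A p)) \<longlonglongrightarrow> 0" "(\<lambda>p. measure (M p) (?B p)) \<longlonglongrightarrow> 0"
      using f g half_gt_zero[OF d(1)] unfolding tendsto_prob_def by blast+
  qed
  show "(\<lambda>p. measure (M p) (?C p)) \<longlonglongrightarrow> 0"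
    by (rule Lim_null_comparison[OF always_eventually lim])
       (simp only: real_norm_def abs_of_nonneg[OF measure_nonneg] le simp_thms)
qed

lemma tendsto_prob_arith:
  assumes M: "\<And>p. prob_space (M p)"
    and f: "tendsto_prob M f L" and g: "tendsto_prob M g K"
  shows tendsto_prob_add: "tendsto_prob M (\<lambda>p x. f p x + g p x) (L + K)"
    and tendsto_prob_diff: "tendsto_prob M (\<lambda>p x. f p x - g p x) (L - K)"
    and tendsto_prob_mult: "tendsto_prob M (\<lambda>p x. f p x * g p x) (L * K)"
    and tendsto_prob_divide: "K \<noteq> 0 \<Longrightarrow> tendsto_prob M (\<lambda>p x. f p x / g p x) (L / K)"
proof -
  note h = tendsto_prob_continuous[OF M f g]
  show "tendsto_prob M (\<lambda>p x. f p x + g p x) (L + K)"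
    using h[of "\<lambda>z. fst z + snd z"] by (simp add: isCont_fst isCont_snd)
  show "tendsto_prob M (\<lambda>p x. f p x - g p x) (L - K)"
    using h[of "\<lambda>z. fst z - snd z"] by (simp add: isCont_fst isCont_snd)
  show "tendsto_prob M (\<lambda>p x. f p x * g p x) (L * K)"
    using h[of "\<lambda>z. fst z * snd z"] by (simp add: isCont_fst isCont_snd)
  show "tendsto_prob M (\<lambda>p x. f p x / g p x) (L / K)" if "K \<noteq> 0"
    using h[of "\<lambda>z. fst z / snd z"] that by (simp add: isCont_fst isCont_snd)
qed

lemma tendsto_prob_compose:
  fixes h :: "real \<Rightarrow> real"
  assumes M: "\<And>p. prob_space (M p)" and f: "tendsto_prob M f L"
    and h[measurable]: "h \<in> borel_measurable borel" and cont: "isCont h L"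
  shows "tendsto_prob M (\<lambda>p x. h (f p x)) (h L)"
proof -
  have "isCont (\<lambda>z. h (fst z)) (L, L)"
    by (rule isCont_o2[OF continuous_fst[OF continuous_ident]]) (use cont in simp)
  then show ?thesis
    using tendsto_prob_continuous[OF M f f, of "\<lambda>z. h (fst z)"] by simp
qed

text \<open>The deviation is below r/2 off the event \<open>?A p\<close> and at most
  \<open>B\<close> on it, so its mean is at most r/2 + B P(\<open>?A p\<close>).\<close>

lemma tendsto_prob_bounded_integral:
  assumes M: "\<And>p. prob_space (M p)" and f: "tendsto_prob M f L"
    and bound: "\<And>p x. \<bar>f p x - L\<bar> \<le> B"
  shows "(\<lambda>p. \<integral>x. f p x \<partial>M p) \<longlonglongrightarrow> L"
proof (rule tendstoI)
  fix r :: real assume "r > 0"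
  let ?A = "\<lambda>p. {x \<in> space (M p). r / 2 \<le> \<bar>f p x - L\<bar>}"
  have "B \<ge> 0" using bound[of undefined undefined] by linarith
  have "(\<lambda>p. measure (M p) (?A p)) \<longlonglongrightarrow> 0"
    using f half_gt_zero[OF \<open>r > 0\<close>] unfolding tendsto_prob_def by blast
  \<comment> \<open>\<open>B + 1\<close> instead of \<open>B\<close> keeps the denominator positive
    when \<open>B = 0\<close>.\<close>
  then have "\<forall>\<^sub>F p in sequentially. measure (M p) (?A p) < r / (2 * (B + 1))"
    using \<open>r > 0\<close> \<open>B \<ge> 0\<close> by (intro order_tendstoD(2)) auto
  then show "\<forall>\<^sub>F p in sequentially. dist (\<integral>x. f p x \<partial>M p) L < r"
  proof eventually_elim
    case (elim p)
    interpret prob_space "M p" by (rule M)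
    have [measurable]: "f p \<in> borel_measurable (M p)" using f unfolding tendsto_prob_def by blast
    have int_diff: "integrable (M p) (\<lambda>x. f p x - L)"
      using bound by (intro integrable_const_bound[of _ B]) auto
    have int: "integrable (M p) (f p)"
      using Bochner_Integration.integrable_add[OF int_diff integrable_const[of L]] by simp
    have "dist (\<integral>x. f p x \<partial>M p) L = \<bar>\<integral>x. f p x - L \<partial>M p\<bar>"
      using int by (simp add: dist_real_def prob_space)
    also have "\<dots> \<le> (\<integral>x. \<bar>f p x - L\<bar> \<partial>M p)"
      by (rule integral_abs_bound)
    also have "\<dots> \<le> (\<integral>x. r / 2 + B * indicator (?A p) x \<partial>M p)"
    proof (rule integral_mono)
      show "integrable (M p) (\<lambda>x. r / 2 + B * indicator (?A p) x)"
        by (intro Bochner_Integration.integrable_add integrable_mult_right integrable_const integrable_real_indicator)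
           (auto simp: less_top[symmetric])
      fix x assume "x \<in> space (M p)"
      then show "\<bar>f p x - L\<bar> \<le> r / 2 + B * indicator (?A p) x"
        using bound[of p x] \<open>r > 0\<close> by (cases "x \<in> ?A p") auto
    qed (use int_diff in simp)
    also have "\<dots> = r / 2 + B * measure (M p) (?A p)"
      by (subst Bochner_Integration.integral_add)
         (auto simp: prob_space less_top[symmetric] intro!: integrable_mult_right integrable_real_indicator)
    also have "\<dots> < r"
    proof -
      have "B * measure (M p) (?A p) \<le> (B + 1) * measure (M p) (?A p)"
        by (intro mult_right_mono) auto
      also have "\<dots> < (B + 1) * (r / (2 * (B + 1)))"
        using elim \<open>B \<ge> 0\<close> by (intro mult_strict_left_mono) auto
      also have "\<dots> = r / 2" using \<open>B \<ge> 0\<close> by (simp add: field_simps)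
      finally show ?thesis by simp
    qed
    finally show ?case .
  qed
qed

section \<open>The standard normal distribution function\<close>

lemma Phi_eq_cdf: "Phi = cdf std_normal_distribution"
  by (rule ext) (simp add: Phi_def cdf_def)

text \<open>A distribution function is continuous at every point without an atom, and a law with a
  Lebesgue density has none.\<close>

lemma isCont_Phi: "isCont Phi x"
proof -
  interpret real_distribution std_normal_distribution by (rule real_dist_normal_dist)
  have "emeasure std_normal_distribution {x} = 0"
    by (subst emeasure_density) (auto intro!: nn_integral_0_iff_AE[THEN iffD2] AE_lborel_singleton[THEN eventually_mono])
  then show ?thesis
    unfolding Phi_eq_cdf isCont_cdf by (simp add: measure_def)
qed

lemma borel_measurable_Phi: "Phi \<in> borel_measurable borel"
  by (intro borel_measurable_continuous_onI continuous_at_imp_continuous_on ballI isCont_Phi)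

lemma Phi_bounds: "0 \<le> Phi x" "Phi x \<le> 1"
proof -
  interpret real_distribution std_normal_distribution by (rule real_dist_normal_dist)
  show "0 \<le> Phi x" "Phi x \<le> 1" by (simp_all add: Phi_def)
qed

section \<open>Statistics of the sample means in the asymptotic regime\<close>

lemma bil_add_left: "bil p S (\<lambda>k. a k + b k) c = bil p S a c + bil p S b c"
  by (simp add: bil_def algebra_simps sum.distrib)

lemma bil_diff_left: "bil p S (\<lambda>k. a k - b k) c = bil p S a c - bil p S b c"
  by (simp add: bil_def algebra_simps sum_subtractf)

lemma bil_diff_right: "bil p S c (\<lambda>k. a k - b k) = bil p S c a - bil p S c b"
  by (simp add: bil_def algebra_simps sum_subtractf)

lemma bil_mult_left: "bil p S (\<lambda>k. r * a k) c = r * bil p S a c"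
  by (simp add: bil_def sum_distrib_left mult_ac)

lemma bil_commute:
  assumes "sym_posdef p S"
  shows "bil p S a b = bil p S b a"
proof -
  obtain C where "whitens p S C"
    using mvn_whitening[OF assms] ..
  then show ?thesis unfolding whitens_def by (simp add: mult.commute)
qed

lemma eta_eq:
  assumes "sym_posdef p S"
  shows "eta p S a b = bil p S a a - 2 * bil p S a b + bil p S b b"
  unfolding eta_def using bil_commute[OF assms, of b a] by (simp add: bil_diff_left bil_diff_right)

text \<open>Reduces the discriminant to four bilinear statistics whose limits can be found
  separately; the part without \<open>v\<close> is the same for every first argument.\<close>

lemma lda_arg_eq:
  assumes "sym_posdef p S"
  shows "lda_arg p S v a b = bil p S v a - bil p S v b - (bil p S a a - bil p S b b) / 2"
proof -
  have "lda_arg p S v a b = bil p S (\<lambda>k. v k - (1 / 2) * (a k + b k)) (\<lambda>k. a k - b k)"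
    by (simp add: lda_arg_def)
  then show ?thesis
    using bil_commute[OF assms, of b a]
    by (simp only: bil_diff_left bil_diff_right bil_add_left bil_mult_left) (simp add: field_simps)
qed

lemma measurable_smean:
  "(\<lambda>X. smean p n X k) \<in> borel_measurable (PiM {..<n} (\<lambda>_. mvn p mu S))"
proof (cases "k < p")
  case True
  have "(\<lambda>X. X t k) \<in> borel_measurable (PiM {..<n} (\<lambda>_. mvn p mu S))" if "t < n" for t
  proof (rule measurable_compose[of "\<lambda>X. X t"])
    show "(\<lambda>X. X t) \<in> PiM {..<n} (\<lambda>_. mvn p mu S) \<rightarrow>\<^sub>M mvn p mu S"
      using that by (intro measurable_component_singleton) simp
    show "(\<lambda>x. x k) \<in> borel_measurable (mvn p mu S)"
      using True by (subst measurable_cong_sets[OF sets_mvn refl], intro measurable_component_singleton) simp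
  qed
  then have "(\<lambda>X. (\<Sum>t<n. X t k) / real n) \<in> borel_measurable (PiM {..<n} (\<lambda>_. mvn p mu S))"
    by (intro borel_measurable_divide borel_measurable_sum) auto
  with True show ?thesis by (simp add: smean_def)
qed (simp add: smean_def)

lemma sample_meas_marginals:
  fixes f :: "(nat \<Rightarrow> rvec) \<Rightarrow> real"
  assumes S: "sym_posdef p S"
  shows "prob_space (sample_meas p S mu0 mu1 n0 n1)"
    and "integrable (PiM {..<n0} (\<lambda>_. mvn p mu0 S)) f \<Longrightarrow>
      integrable (sample_meas p S mu0 mu1 n0 n1) (\<lambda>X. f (fst X)) \<and>
      (\<integral>X. f (fst X) \<partial>sample_meas p S mu0 mu1 n0 n1) = (\<integral>X. f X \<partial>PiM {..<n0} (\<lambda>_. mvn p mu0 S))"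
    and "integrable (PiM {..<n1} (\<lambda>_. mvn p mu1 S)) f \<Longrightarrow>
      integrable (sample_meas p S mu0 mu1 n0 n1) (\<lambda>X. f (snd X)) \<and>
      (\<integral>X. f (snd X) \<partial>sample_meas p S mu0 mu1 n0 n1) = (\<integral>X. f X \<partial>PiM {..<n1} (\<lambda>_. mvn p mu1 S))"
proof -
  let ?P = "\<lambda>n mu. PiM {..<n} (\<lambda>_. mvn p mu S)"
  have prob: "prob_space (?P n mu)" for n :: nat and mu
    by (intro prob_space_PiM prob_space_mvn[OF S])
  interpret P: pair_prob_space "?P n0 mu0" "?P n1 mu1"
    using prob[of n0 mu0] prob[of n1 mu1]
    by (simp add: pair_prob_space_def pair_sigma_finite_def prob_space_imp_sigma_finite)
  show "prob_space (sample_meas p S mu0 mu1 n0 n1)"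
    unfolding sample_meas_def by (rule P.prob_space_axioms)
  show "integrable (sample_meas p S mu0 mu1 n0 n1) (\<lambda>X. f (fst X)) \<and>
      (\<integral>X. f (fst X) \<partial>sample_meas p S mu0 mu1 n0 n1) = (\<integral>X. f X \<partial>?P n0 mu0)"
    if "integrable (?P n0 mu0) f"
    using P.integral_times_fst_snd[OF that, of "\<lambda>_. 1"] unfolding sample_meas_def
    by (simp add: P.M2.prob_space)
  show "integrable (sample_meas p S mu0 mu1 n0 n1) (\<lambda>X. f (snd X)) \<and>
      (\<integral>X. f (snd X) \<partial>sample_meas p S mu0 mu1 n0 n1) = (\<integral>X. f X \<partial>?P n1 mu1)"
    if "integrable (?P n1 mu1) f"
    using P.integral_times_fst_snd[OF _ that, of "\<lambda>_. 1"] unfolding sample_meas_def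
    by (simp add: P.M1.prob_space)
qed

text \<open>The classes are indexed by \<open>i \<in> {0, 1}\<close> so that each limit is proved
  once for both; values at other indices are left unconstrained.\<close>

locale lda_regime =
  fixes Sig :: "nat \<Rightarrow> rmat" and mu m :: "nat \<Rightarrow> nat \<Rightarrow> rvec" and n :: "nat \<Rightarrow> nat \<Rightarrow> nat"
    and nu :: "nat \<Rightarrow> nat \<Rightarrow> real" and J g :: "nat \<Rightarrow> real"
  assumes Sig: "\<And>p. sym_posdef p (Sig p)"
    and n_inf: "\<And>i. i \<in> {0, 1} \<Longrightarrow> filterlim (n i) at_top sequentially"
    and nu_pos: "\<And>i p. i \<in> {0, 1} \<Longrightarrow> nu i p > 0"
    and J: "\<And>i. i \<in> {0, 1} \<Longrightarrow> (\<lambda>p. real p / real (n i p)) \<longlonglongrightarrow> J i"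
    and gam: "\<And>i. i \<in> {0, 1} \<Longrightarrow> (\<lambda>p. nu i p / real (n i p)) \<longlonglongrightarrow> g i"
    and conv: "\<And>a b. a \<in> {m 0, m 1, mu 0, mu 1} \<Longrightarrow> b \<in> {m 0, m 1, mu 0, mu 1} \<Longrightarrow>
      convergent (\<lambda>p. bil p (Sig p) (a p) (b p))"
begin

definition M :: "nat \<Rightarrow> ((nat \<Rightarrow> rvec) \<times> (nat \<Rightarrow> rvec)) measure" where
  "M p = sample_meas p (Sig p) (mu 0 p) (mu 1 p) (n 0 p) (n 1 p)"

definition xbar :: "nat \<Rightarrow> nat \<Rightarrow> (nat \<Rightarrow> rvec) \<times> (nat \<Rightarrow> rvec) \<Rightarrow> rvec" where
  "xbar i p X = smean p (n i p) (if i = 0 then fst X else snd X)"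

definition B :: "nat \<Rightarrow> rvec \<Rightarrow> rvec \<Rightarrow> real" where
  "B p = bil p (Sig p)"

definition K :: "(nat \<Rightarrow> rvec) \<Rightarrow> (nat \<Rightarrow> rvec) \<Rightarrow> real" where
  "K a b = lim (\<lambda>p. B p (a p) (b p))"

definition "det_vecs = {m 0, m 1, mu 0, mu 1}"

lemma mem_det_vecs: "i \<in> {0, 1} \<Longrightarrow> mu i \<in> det_vecs" "i \<in> {0, 1} \<Longrightarrow> m i \<in> det_vecs"
  unfolding det_vecs_def by auto

lemma tendsto_K: "a \<in> det_vecs \<Longrightarrow> b \<in> det_vecs \<Longrightarrow> (\<lambda>p. B p (a p) (b p)) \<longlonglongrightarrow> K a b"
  using conv[of a b] unfolding K_def B_def det_vecs_def by (simp add: convergent_LIMSEQ_iff)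

lemma B_commute: "B p a b = B p b a"
  unfolding B_def by (rule bil_commute[OF Sig])

lemma K_commute: "K a b = K b a"
  unfolding K_def by (subst B_commute) (rule refl)

lemma tendsto_eta: "a \<in> det_vecs \<Longrightarrow> b \<in> det_vecs \<Longrightarrow>
    (\<lambda>p. eta p (Sig p) (a p) (b p)) \<longlonglongrightarrow> K a a - 2 * K a b + K b b"
  unfolding eta_eq[OF Sig] B_def[symmetric] by (intro tendsto_intros tendsto_K)

lemma prob_space_M: "prob_space (M p)"
  unfolding M_def by (rule sample_meas_marginals(1)[OF Sig])

lemma measurable_xbar: "i \<in> {0, 1} \<Longrightarrow> (\<lambda>X. xbar i p X k) \<in> borel_measurable (M p)"
  unfolding M_def sample_meas_def xbar_def
  by (auto intro!: measurable_compose[OF measurable_fst measurable_smean]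
        measurable_compose[OF measurable_snd measurable_smean])

lemma measurable_B:
  "(\<And>k. (\<lambda>X. a X k) \<in> borel_measurable (M p)) \<Longrightarrow> (\<And>k. (\<lambda>X. b X k) \<in> borel_measurable (M p)) \<Longrightarrow>
    (\<lambda>X. B p (a X) (b X)) \<in> borel_measurable (M p)"
  unfolding B_def by (rule measurable_bil)

lemma measurable_err: "i \<in> {0, 1} \<Longrightarrow> (\<lambda>X. xbar i p X k - mu i p k) \<in> borel_measurable (M p)"
  using measurable_xbar by simp

lemma n_pos: "i \<in> {0, 1} \<Longrightarrow> \<forall>\<^sub>F p in sequentially. n i p > 0"
  using filterlim_at_top[THEN iffD1, OF n_inf, of i]
  by (auto dest!: spec[of _ 1] elim!: eventually_mono)

lemma inverse_n: "i \<in> {0, 1} \<Longrightarrow> (\<lambda>p. 1 / real (n i p)) \<longlonglongrightarrow> 0"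
  using n_inf[of i] by (intro tendsto_divide_0[OF tendsto_const] filterlim_at_top_imp_at_infinity
      filterlim_compose[OF filterlim_real_sequentially]) auto

lemma marginal:
  fixes f :: "(nat \<Rightarrow> rvec) \<Rightarrow> real"
  assumes "i \<in> {0, 1}" "integrable (PiM {..<n i p} (\<lambda>_. mvn p (mu i p) (Sig p))) f"
  shows "integrable (M p) (\<lambda>X. f (if i = 0 then fst X else snd X))"
    and "(\<integral>X. f (if i = 0 then fst X else snd X) \<partial>M p) =
      (\<integral>X. f X \<partial>PiM {..<n i p} (\<lambda>_. mvn p (mu i p) (Sig p)))"
  using assms sample_meas_marginals(2,3)[OF Sig[of p], where f = f and ?mu0.0 = "mu 0 p"
      and ?mu1.0 = "mu 1 p" and ?n0.0 = "n 0 p" and ?n1.0 = "n 1 p"]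
  unfolding M_def by auto

section \<open>Limits of the bilinear statistics of the sample means\<close>

lemma tendsto_prob_linear_err:
  assumes i: "i \<in> {0, 1}" and v: "v \<in> det_vecs"
  shows "tendsto_prob M (\<lambda>p X. B p (v p) (\<lambda>k. xbar i p X k - mu i p k)) 0"
proof (rule tendsto_prob_square_mean[where b = "\<lambda>p. B p (v p) (v p) * (1 / real (n i p))"])
  show "(\<lambda>p. B p (v p) (v p) * (1 / real (n i p))) \<longlonglongrightarrow> 0"
    using tendsto_mult[OF tendsto_K[OF v v] inverse_n[OF i]] by simp
  show "\<forall>\<^sub>F p in sequentially. integrable (M p) (\<lambda>X. (B p (v p) (\<lambda>k. xbar i p X k - mu i p k))\<^sup>2) \<and>
      (\<integral>X. (B p (v p) (\<lambda>k. xbar i p X k - mu i p k))\<^sup>2 \<partial>M p) = B p (v p) (v p) * (1 / real (n i p))"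
    using n_pos[OF i]
  proof eventually_elim
    case (elim p)
    note mom = bil_smean_moments(1,2)[OF Sig elim, where mu = "mu i p" and v = "v p"]
    show ?case
      using marginal[OF i mom(1)] mom(2) unfolding xbar_def B_def by simp
  qed
qed (rule prob_space_M, rule measurable_B, simp, rule measurable_err[OF i])

text \<open>The source of every \<open>J i\<close> in the result: the mean p/n tends to
  \<open>J i\<close>, while the variance 2 (p/n)(1/n) vanishes.\<close>

lemma tendsto_prob_quadratic_err:
  assumes i: "i \<in> {0, 1}"
  shows "tendsto_prob M (\<lambda>p X. B p (\<lambda>k. xbar i p X k - mu i p k) (\<lambda>k. xbar i p X k - mu i p k)) (J i)"
proof -
  let ?Q = "\<lambda>p X. B p (\<lambda>k. xbar i p X k - mu i p k) (\<lambda>k. xbar i p X k - mu i p k)"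
  have "tendsto_prob M (\<lambda>p X. ?Q p X - real p / real (n i p)) 0"
  proof (rule tendsto_prob_square_mean[where b = "\<lambda>p. 2 * (real p / real (n i p)) * (1 / real (n i p))"])
    show "(\<lambda>p. 2 * (real p / real (n i p)) * (1 / real (n i p))) \<longlonglongrightarrow> 0"
      using tendsto_mult[OF tendsto_mult[OF tendsto_const J[OF i]] inverse_n[OF i], of 2] by simp
    show "\<forall>\<^sub>F p in sequentially. integrable (M p) (\<lambda>X. (?Q p X - real p / real (n i p))\<^sup>2) \<and>
        (\<integral>X. (?Q p X - real p / real (n i p))\<^sup>2 \<partial>M p) = 2 * (real p / real (n i p)) * (1 / real (n i p))"
      using n_pos[OF i]
    proof eventually_elim
      case (elim p)
      note mom = bil_smean_moments(3,4)[OF Sig elim, where mu = "mu i p"]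
      show ?case
        using marginal[OF i mom(1)] mom(2) unfolding xbar_def B_def by (simp add: power2_eq_square)
    qed
  qed (rule prob_space_M, intro borel_measurable_diff measurable_B measurable_err[OF i], simp)
  from tendsto_prob_add[OF prob_space_M this tendsto_prob_const[OF J[OF i]]]
  show ?thesis by simp
qed

lemma tendsto_prob_cross_err:
  "tendsto_prob M (\<lambda>p X. B p (\<lambda>k. xbar 0 p X k - mu 0 p k) (\<lambda>k. xbar 1 p X k - mu 1 p k)) 0"
proof (rule tendsto_prob_square_mean[where b = "\<lambda>p. (real p / real (n 0 p)) * (1 / real (n 1 p))"])
  show "(\<lambda>p. (real p / real (n 0 p)) * (1 / real (n 1 p))) \<longlonglongrightarrow> 0"
    using tendsto_mult[OF J[of 0] inverse_n[of 1]] by simp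
  have "\<forall>\<^sub>F p in sequentially. n 0 p > 0" "\<forall>\<^sub>F p in sequentially. n 1 p > 0"
    by (intro n_pos; simp)+
  then show "\<forall>\<^sub>F p in sequentially.
      integrable (M p) (\<lambda>X. (B p (\<lambda>k. xbar 0 p X k - mu 0 p k) (\<lambda>k. xbar 1 p X k - mu 1 p k))\<^sup>2) \<and>
      (\<integral>X. (B p (\<lambda>k. xbar 0 p X k - mu 0 p k) (\<lambda>k. xbar 1 p X k - mu 1 p k))\<^sup>2 \<partial>M p) =
      (real p / real (n 0 p)) * (1 / real (n 1 p))"
  proof eventually_elim
    case (elim p)
    show ?case
      using bil_smean_cross_moment[OF Sig elim, where ?mu0.0 = "mu 0 p" and ?mu1.0 = "mu 1 p"] unfolding xbar_def B_def M_def by simp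
  qed
qed (rule prob_space_M, intro measurable_B measurable_err, simp_all)

lemma tendsto_prob_B_det:
  "a \<in> det_vecs \<Longrightarrow> b \<in> det_vecs \<Longrightarrow> tendsto_prob M (\<lambda>p X. B p (a p) (b p)) (K a b)"
  by (intro tendsto_prob_const tendsto_K)

lemma tendsto_prob_B_xbar:
  assumes i: "i \<in> {0, 1}" and v: "v \<in> det_vecs"
  shows "tendsto_prob M (\<lambda>p X. B p (v p) (xbar i p X)) (K v (mu i))"
  using tendsto_prob_add[OF prob_space_M tendsto_prob_linear_err[OF i v]
      tendsto_prob_B_det[OF v mem_det_vecs(1)[OF i]]]
  unfolding B_def by (simp add: bil_diff_right)

text \<open>With xbar = mu + e, B(xbar, xbar) = B(e, e) + 2 B(mu, xbar) - B(mu, mu), and the limit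
  of each term is known.\<close>

lemma tendsto_prob_xbar_xbar:
  assumes i: "i \<in> {0, 1}"
  shows "tendsto_prob M (\<lambda>p X. B p (xbar i p X) (xbar i p X)) (K (mu i) (mu i) + J i)"
proof -
  note mu = mem_det_vecs(1)[OF i]
  have "tendsto_prob M (\<lambda>p X. (B p (\<lambda>k. xbar i p X k - mu i p k) (\<lambda>k. xbar i p X k - mu i p k)
      + 2 * B p (mu i p) (xbar i p X)) - B p (mu i p) (mu i p)) ((J i + 2 * K (mu i) (mu i)) - K (mu i) (mu i))"
    by (intro tendsto_prob_diff tendsto_prob_add tendsto_prob_mult prob_space_M
        tendsto_prob_const tendsto_const tendsto_prob_quadratic_err tendsto_prob_B_xbar tendsto_K i mu)
  moreover have "(B p (\<lambda>k. xbar i p X k - mu i p k) (\<lambda>k. xbar i p X k - mu i p k)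
      + 2 * B p (mu i p) (xbar i p X)) - B p (mu i p) (mu i p) = B p (xbar i p X) (xbar i p X)" for p X
    using B_commute[of p "mu i p" "xbar i p X"] unfolding B_def by (simp add: bil_diff_left bil_diff_right)
  ultimately show ?thesis by (simp add: add.commute)
qed

text \<open>Same expansion for two classes; no J appears because independent errors are
  asymptotically orthogonal.\<close>

lemma tendsto_prob_xbar0_xbar1:
  "tendsto_prob M (\<lambda>p X. B p (xbar 0 p X) (xbar 1 p X)) (K (mu 0) (mu 1))"
proof -
  have 01: "0 \<in> {0, 1::nat}" "1 \<in> {0, 1::nat}" by simp_all
  note mu = mem_det_vecs(1)[OF 01(1)] mem_det_vecs(1)[OF 01(2)]
  have "tendsto_prob M (\<lambda>p X. B p (\<lambda>k. xbar 0 p X k - mu 0 p k) (\<lambda>k. xbar 1 p X k - mu 1 p k)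
      + B p (mu 0 p) (xbar 1 p X) + B p (mu 1 p) (xbar 0 p X) - B p (mu 0 p) (mu 1 p))
      (0 + K (mu 0) (mu 1) + K (mu 1) (mu 0) - K (mu 0) (mu 1))"
    by (intro tendsto_prob_diff tendsto_prob_add prob_space_M
        tendsto_prob_cross_err tendsto_prob_B_xbar tendsto_prob_B_det 01 mu)
  moreover have "B p (\<lambda>k. xbar 0 p X k - mu 0 p k) (\<lambda>k. xbar 1 p X k - mu 1 p k)
      + B p (mu 0 p) (xbar 1 p X) + B p (mu 1 p) (xbar 0 p X) - B p (mu 0 p) (mu 1 p) =
      B p (xbar 0 p X) (xbar 1 p X)" for p X
    using B_commute[of p "mu 1 p" "xbar 0 p X"] unfolding B_def by (simp add: bil_diff_left bil_diff_right)
  ultimately show ?thesis by (simp add: K_commute)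
qed

lemma tendsto_prob_xbar_pair:
  assumes "i \<in> {0, 1}" "j \<in> {0, 1}"
  shows "tendsto_prob M (\<lambda>p X. B p (xbar i p X) (xbar j p X)) (K (mu i) (mu j) + (if i = j then J i else 0))"
proof -
  have "tendsto_prob M (\<lambda>p X. B p (xbar 1 p X) (xbar 0 p X)) (K (mu 1) (mu 0))"
    using tendsto_prob_xbar0_xbar1 by (simp add: B_commute[of _ "xbar 0 _ _"] K_commute[of "mu 0"])
  then show ?thesis
    using assms tendsto_prob_xbar_xbar[of 0] tendsto_prob_xbar_xbar[of 1] tendsto_prob_xbar0_xbar1 by auto
qed

text \<open>Half the limit of \<open>B(xbar\<^sub>0, xbar\<^sub>0) - B(xbar\<^sub>1, xbar\<^sub>1)\<close>, the part of \<open>lda_arg\<close> that does not involve its first vector.\<close>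

definition mid :: real where
  "mid = (K (mu 0) (mu 0) + J 0 - (K (mu 1) (mu 1) + J 1)) / 2"

text \<open>The first vector may depend on the sample: the rule serves the deterministic means as
  well as the sample mean inside the posterior mean.\<close>

lemma tendsto_prob_lda_arg:
  assumes "tendsto_prob M (\<lambda>p X. B p (v p X) (xbar 0 p X)) L0"
    and "tendsto_prob M (\<lambda>p X. B p (v p X) (xbar 1 p X)) L1"
  shows "tendsto_prob M (\<lambda>p X. lda_arg p (Sig p) (v p X) (xbar 0 p X) (xbar 1 p X)) (L0 - L1 - mid)"
  unfolding lda_arg_eq[OF Sig] B_def[symmetric] mid_def
  by (intro tendsto_prob_diff tendsto_prob_divide prob_space_M assms tendsto_prob_const tendsto_const
      tendsto_prob_xbar_xbar) simp_all

definition D :: real where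
  "D = K (mu 0) (mu 0) - 2 * K (mu 0) (mu 1) + K (mu 1) (mu 1) + J 0 + J 1"

lemma tendsto_prob_dhat: "tendsto_prob M (\<lambda>p X. dhat p (Sig p) (xbar 0 p X) (xbar 1 p X)) (sqrt D)"
proof -
  have "tendsto_prob M (\<lambda>p X. B p (xbar 0 p X) (xbar 0 p X) - 2 * B p (xbar 0 p X) (xbar 1 p X) +
     B p (xbar 1 p X) (xbar 1 p X))
     ((K (mu 0) (mu 0) + J 0) - 2 * K (mu 0) (mu 1) + (K (mu 1) (mu 1) + J 1))"
    by (intro tendsto_prob_diff tendsto_prob_add tendsto_prob_mult prob_space_M tendsto_prob_const
        tendsto_const tendsto_prob_xbar0_xbar1 tendsto_prob_xbar_xbar) simp_all
  then have "tendsto_prob M (\<lambda>p X. eta p (Sig p) (xbar 0 p X) (xbar 1 p X)) D"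
    unfolding eta_eq[OF Sig] B_def[symmetric] D_def by (simp add: algebra_simps)
  then show ?thesis
    unfolding dhat_def by (intro tendsto_prob_compose[of M _ D sqrt] prob_space_M) (auto intro: isCont_real_sqrt)
qed

section \<open>Limits of the true error and of its estimator\<close>

lemma tendsto_prob_eps_true:
  assumes D: "D > 0" and j: "j \<in> {0, 1}"
  shows "tendsto_prob M (\<lambda>p X. eps_true a0 p (Sig p) (mu 0 p) (mu 1 p) j (xbar 0 p X) (xbar 1 p X))
    (Phi ((-1) ^ j * ((- (K (mu j) (mu 0) - K (mu j) (mu 1) - mid) + lda_c a0) / sqrt D)))"
proof -
  have "tendsto_prob M (\<lambda>p X. ((-1) ^ (j + 1) * lda_arg p (Sig p) (mu j p) (xbar 0 p X) (xbar 1 p X)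
      + (-1) ^ j * lda_c a0) / dhat p (Sig p) (xbar 0 p X) (xbar 1 p X))
     (((-1) ^ (j + 1) * (K (mu j) (mu 0) - K (mu j) (mu 1) - mid) + (-1) ^ j * lda_c a0) / sqrt D)"
    using D j
    by (intro tendsto_prob_divide tendsto_prob_add tendsto_prob_mult prob_space_M tendsto_prob_const
        tendsto_const tendsto_prob_dhat tendsto_prob_lda_arg tendsto_prob_B_xbar mem_det_vecs(1)) auto
  from tendsto_prob_compose[OF prob_space_M this borel_measurable_Phi isCont_Phi]
  show ?thesis
    using j by (auto simp: eps_true_def algebra_simps)
qed

text \<open>The discriminant is affine, not linear, in its first argument; weights that sum to 1
  preserve the midpoint term. This splits the posterior mean into its data part and its prior
  part.\<close>

lemma lda_arg_affine:
  assumes "w + u = 1"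
  shows "lda_arg p (Sig p) (\<lambda>k. w * x k + u * y k) a b =
    w * lda_arg p (Sig p) x a b + u * lda_arg p (Sig p) y a b"
proof -
  have u: "u = 1 - w" using assms by simp
  show ?thesis
    unfolding lda_arg_eq[OF Sig] bil_add_left bil_mult_left u by (simp add: field_simps)
qed

lemma g_nonneg:
  assumes i: "i \<in> {0, 1}"
  shows "g i \<ge> 0"
proof -
  have "0 \<le> nu i p / real (n i p)" for p
    using nu_pos[OF i, of p] by simp
  then show ?thesis
    using tendsto_lowerbound[OF gam[OF i]] by simp
qed

text \<open>Every fraction is divided through by n, which is legitimate once n > 0. In the shrinkage
  factor the additional 1 becomes 1/n and disappears, so the factor tends to 1.\<close>

lemma posterior_weights:
  assumes i: "i \<in> {0, 1}"
  shows "(\<lambda>p. real (n i p) / (real (n i p) + nu i p)) \<longlonglongrightarrow> 1 / (1 + g i)"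
    and "(\<lambda>p. nu i p / (real (n i p) + nu i p)) \<longlonglongrightarrow> g i / (1 + g i)"
    and "(\<lambda>p. sqrt ((real (n i p) + nu i p) / (real (n i p) + nu i p + 1))) \<longlonglongrightarrow> 1"
proof -
  have g: "1 + g i \<noteq> 0" using g_nonneg[OF i] by simp
  have "(\<lambda>p. 1 / (1 + nu i p / real (n i p))) \<longlonglongrightarrow> 1 / (1 + g i)"
    using g by (intro tendsto_intros gam i)
  moreover have "\<forall>\<^sub>F p in sequentially. 1 / (1 + nu i p / real (n i p)) = real (n i p) / (real (n i p) + nu i p)"
    using n_pos[OF i] by eventually_elim (simp add: field_simps)
  ultimately show "(\<lambda>p. real (n i p) / (real (n i p) + nu i p)) \<longlonglongrightarrow> 1 / (1 + g i)"
    by (rule Lim_transform_eventually)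
  have "(\<lambda>p. (nu i p / real (n i p)) / (1 + nu i p / real (n i p))) \<longlonglongrightarrow> g i / (1 + g i)"
    using g by (intro tendsto_intros gam i)
  moreover have "\<forall>\<^sub>F p in sequentially. (nu i p / real (n i p)) / (1 + nu i p / real (n i p)) = nu i p / (real (n i p) + nu i p)"
    using n_pos[OF i] by eventually_elim (simp add: field_simps)
  ultimately show "(\<lambda>p. nu i p / (real (n i p) + nu i p)) \<longlonglongrightarrow> g i / (1 + g i)"
    by (rule Lim_transform_eventually)
  have "(\<lambda>p. 1 / (1 + nu i p / real (n i p) + 1 / real (n i p))) \<longlonglongrightarrow> 1 / (1 + g i + 0)"
    using g by (intro tendsto_intros gam inverse_n i) simp_all
  moreover have "(\<lambda>p. 1 + nu i p / real (n i p)) \<longlonglongrightarrow> 1 + g i"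
    by (intro tendsto_intros gam i)
  ultimately have "(\<lambda>p. sqrt ((1 + nu i p / real (n i p)) * (1 / (1 + nu i p / real (n i p) + 1 / real (n i p)))))
      \<longlonglongrightarrow> sqrt ((1 + g i) * (1 / (1 + g i + 0)))"
    by (intro tendsto_real_sqrt tendsto_mult)
  moreover have "\<forall>\<^sub>F p in sequentially. sqrt ((1 + nu i p / real (n i p)) * (1 / (1 + nu i p / real (n i p) + 1 / real (n i p)))) =
      sqrt ((real (n i p) + nu i p) / (real (n i p) + nu i p + 1))"
    using n_pos[OF i]
  proof eventually_elim
    case (elim p)
    then have "real (n i p) * (1 + nu i p / real (n i p)) = real (n i p) + nu i p"
      "real (n i p) * (1 + nu i p / real (n i p) + 1 / real (n i p)) = real (n i p) + nu i p + 1"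
      by (simp_all add: field_simps)
    then show ?case
      using elim mult_divide_mult_cancel_left[of "real (n i p)"] by (metis mult.right_neutral of_nat_0_less_iff less_irrefl times_divide_eq_right)
  qed
  ultimately have "(\<lambda>p. sqrt ((real (n i p) + nu i p) / (real (n i p) + nu i p + 1))) \<longlonglongrightarrow>
      sqrt ((1 + g i) * (1 / (1 + g i + 0)))"
    by (rule Lim_transform_eventually)
  then show "(\<lambda>p. sqrt ((real (n i p) + nu i p) / (real (n i p) + nu i p + 1))) \<longlonglongrightarrow> 1"
    using g by simp
qed

text \<open>The limit inside \<open>Phi\<close> is the weighted mean of two discriminant limits. In
  the data part \<open>xbar i\<close> meets itself, which adds \<open>J i\<close> to one of the two
  pairings.\<close>

lemma tendsto_prob_eps_bayes:
  assumes D: "D > 0" and i: "i \<in> {0, 1}"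
  shows "tendsto_prob M (\<lambda>p X. eps_bayes a0 p (Sig p) (m 0 p) (m 1 p) (n 0 p) (n 1 p) (nu 0 p) (nu 1 p) i
      (xbar 0 p X) (xbar 1 p X))
    (Phi ((-1) ^ i * ((- (1 / (1 + g i) * (K (mu i) (mu 0) + (if i = 0 then J 0 else 0)
        - (K (mu i) (mu 1) + (if i = 1 then J 1 else 0)) - mid)
      + g i / (1 + g i) * (K (m i) (mu 0) - K (m i) (mu 1) - mid)) + lda_c a0) / sqrt D)))"
    (is "tendsto_prob M _ (Phi ((-1) ^ i * ((- ?G + _) / _)))")
proof -
  define w u where "w = (\<lambda>p. real (n i p) / (real (n i p) + nu i p))" and "u = (\<lambda>p. nu i p / (real (n i p) + nu i p))"
  define s where "s = (\<lambda>p. sqrt ((real (n i p) + nu i p) / (real (n i p) + nu i p + 1)))"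
  note lims = posterior_weights[OF i, folded w_def u_def s_def]
  have "tendsto_prob M (\<lambda>p X. B p (xbar i p X) (xbar 0 p X)) (K (mu i) (mu 0) + (if i = 0 then J 0 else 0))"
    "tendsto_prob M (\<lambda>p X. B p (xbar i p X) (xbar 1 p X)) (K (mu i) (mu 1) + (if i = 1 then J 1 else 0))"
    using tendsto_prob_xbar_pair[OF i, of 0] tendsto_prob_xbar_pair[OF i, of 1] by auto
  note lda_x = tendsto_prob_lda_arg[OF this]
  have lda_m: "tendsto_prob M (\<lambda>p X. lda_arg p (Sig p) (m i p) (xbar 0 p X) (xbar 1 p X))
      (K (m i) (mu 0) - K (m i) (mu 1) - mid)"
    using i by (intro tendsto_prob_lda_arg tendsto_prob_B_xbar mem_det_vecs(2)) auto
  have "tendsto_prob M (\<lambda>p X. (-1) ^ i * ((- (w p * lda_arg p (Sig p) (xbar i p X) (xbar 0 p X) (xbar 1 p X)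
      + u p * lda_arg p (Sig p) (m i p) (xbar 0 p X) (xbar 1 p X)) + lda_c a0)
        / dhat p (Sig p) (xbar 0 p X) (xbar 1 p X)) * s p)
     ((-1) ^ i * ((- ?G + lda_c a0) / sqrt D) * 1)"
    \<comment> \<open>Unary minus becomes \<open>0 - x\<close>, so that the rule for differences
      applies.\<close>
    using D unfolding minus_mult_minus diff_0[symmetric]
    by (intro tendsto_prob_divide tendsto_prob_add tendsto_prob_diff tendsto_prob_mult prob_space_M tendsto_prob_const
        tendsto_const tendsto_prob_dhat lda_x lda_m lims) auto
  from tendsto_prob_compose[OF prob_space_M this borel_measurable_Phi isCont_Phi]
  have lim: "tendsto_prob M (\<lambda>p X. Phi ((-1) ^ i * ((- (w p * lda_arg p (Sig p) (xbar i p X) (xbar 0 p X) (xbar 1 p X)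
      + u p * lda_arg p (Sig p) (m i p) (xbar 0 p X) (xbar 1 p X)) + lda_c a0)
        / dhat p (Sig p) (xbar 0 p X) (xbar 1 p X)) * s p))
     (Phi ((-1) ^ i * ((- ?G + lda_c a0) / sqrt D)))"
    by simp
  have eq: "eps_bayes a0 p (Sig p) (m 0 p) (m 1 p) (n 0 p) (n 1 p) (nu 0 p) (nu 1 p) i (xbar 0 p X) (xbar 1 p X) =
    Phi ((-1) ^ i * ((- (w p * lda_arg p (Sig p) (xbar i p X) (xbar 0 p X) (xbar 1 p X)
      + u p * lda_arg p (Sig p) (m i p) (xbar 0 p X) (xbar 1 p X)) + lda_c a0)
        / dhat p (Sig p) (xbar 0 p X) (xbar 1 p X)) * s p)" for p X
  proof -
    \<comment> \<open>Positivity of \<open>nu\<close> covers the case of an empty sample, so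
      \<open>eq\<close> holds for every \<open>p\<close> and not just eventually.\<close>
    have "real (n i p) + nu i p \<noteq> 0" using nu_pos[OF i, of p] by (smt (verit) of_nat_0_le_iff)
    then have "w p + u p = 1"
      unfolding w_def u_def by (simp add: add_divide_distrib[symmetric])
    then have "w p * lda_arg p (Sig p) (xbar i p X) (xbar 0 p X) (xbar 1 p X)
        + u p * lda_arg p (Sig p) (m i p) (xbar 0 p X) (xbar 1 p X) =
      lda_arg p (Sig p) (\<lambda>k. w p * xbar i p X k + u p * m i p k) (xbar 0 p X) (xbar 1 p X)"
      by (rule lda_arg_affine[symmetric])
    also have "(\<lambda>k. w p * xbar i p X k + u p * m i p k) =
        (\<lambda>k. (real (n i p) * xbar i p X k + nu i p * m i p k) / (real (n i p) + nu i p))"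
      unfolding w_def u_def by (simp add: add_divide_distrib)
    finally show ?thesis
      using i unfolding eps_bayes_def Let_def s_def by (elim insertE) simp_all
  qed
  show ?thesis unfolding eq by (rule lim)
qed

end

section \<open>Identification of the constants and passage to expectations\<close>

theorem theorem4:
  fixes a0 :: real
    and Sig :: "nat \<Rightarrow> rmat"
    and mu0 mu1 m0 m1 :: "nat \<Rightarrow> rvec"
    and n0 n1 :: "nat \<Rightarrow> nat"
    and nu0 nu1 :: "nat \<Rightarrow> real"
    and J0 J1 g0 g1 :: real
  assumes a0: "0 < a0" "a0 < 1"
    and Sig: "\<And>p. sym_posdef p (Sig p)"
    and nu_pos: "\<And>p. 0 < nu0 p" "\<And>p. 0 < nu1 p"
    and n_inf: "filterlim n0 at_top sequentially" "filterlim n1 at_top sequentially"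
    and nu_inf: "filterlim nu0 at_top sequentially" "filterlim nu1 at_top sequentially"
    and J: "(\<lambda>p. real p / real (n0 p)) \<longlonglongrightarrow> J0" "(\<lambda>p. real p / real (n1 p)) \<longlonglongrightarrow> J1"
    and gam: "(\<lambda>p. nu0 p / real (n0 p)) \<longlonglongrightarrow> g0" "(\<lambda>p. nu1 p / real (n1 p)) \<longlonglongrightarrow> g1"
    and conv: "\<And>a b. a \<in> {m0, m1, mu0, mu1} \<Longrightarrow> b \<in> {m0, m1, mu0, mu1} \<Longrightarrow>
                  convergent (\<lambda>p. bil p (Sig p) (a p) (b p))"
    and Dpos: "lim (\<lambda>p. eta p (Sig p) (mu0 p) (mu1 p)) + J0 + J1 > 0"
  shows
   "(let c = lda_c a0;
         d2 = lim (\<lambda>p. eta p (Sig p) (mu0 p) (mu1 p));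
         D = d2 + J0 + J1;
         GB = (\<lambda>i::nat. if i = 0 then
                 1 / (2 * (1 + g0)) * (g0 * (lim (\<lambda>p. eta p (Sig p) (m0 p) (mu1 p))
                    - lim (\<lambda>p. eta p (Sig p) (m0 p) (mu0 p))) + d2 + (1 - g0) * J0 + (1 + g0) * J1)
               else
                 -1 / (2 * (1 + g1)) * (g1 * (lim (\<lambda>p. eta p (Sig p) (m1 p) (mu0 p))
                    - lim (\<lambda>p. eta p (Sig p) (m1 p) (mu1 p))) + d2 + (1 - g1) * J1 + (1 + g1) * J0));
         G = (\<lambda>i::nat. if i = 0 then (d2 + J1 - J0) / 2 else - (d2 + J0 - J1) / 2);
         L = (\<lambda>i j. Phi ((-1) ^ i * ((- GB i + c) / sqrt D)) * Phi ((-1) ^ j * ((- G j + c) / sqrt D)))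
     in (\<forall>i\<in>{0,1}. \<forall>j\<in>{0,1}.
           (\<lambda>p. \<integral>X. eps_bayes a0 p (Sig p) (m0 p) (m1 p) (n0 p) (n1 p) (nu0 p) (nu1 p) i
                        (smean p (n0 p) (fst X)) (smean p (n1 p) (snd X))
                    * eps_true a0 p (Sig p) (mu0 p) (mu1 p) j
                        (smean p (n0 p) (fst X)) (smean p (n1 p) (snd X))
                 \<partial>sample_meas p (Sig p) (mu0 p) (mu1 p) (n0 p) (n1 p))
           \<longlonglongrightarrow> L i j)
      \<and> (\<lambda>p. \<integral>X. eps_bayes_tot a0 p (Sig p) (m0 p) (m1 p) (n0 p) (n1 p) (nu0 p) (nu1 p)
                        (smean p (n0 p) (fst X)) (smean p (n1 p) (snd X))
                    * eps_true_tot a0 p (Sig p) (mu0 p) (mu1 p)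
                        (smean p (n0 p) (fst X)) (smean p (n1 p) (snd X))
                 \<partial>sample_meas p (Sig p) (mu0 p) (mu1 p) (n0 p) (n1 p))
           \<longlonglongrightarrow> (\<Sum>i\<in>{0,1}. \<Sum>j\<in>{0,1}. alpha a0 i * alpha a0 j * L i j))"
proof -
  let ?mu = "\<lambda>i::nat. if i = 0 then mu0 else mu1" and ?m = "\<lambda>i::nat. if i = 0 then m0 else m1"
  let ?n = "\<lambda>i::nat. if i = 0 then n0 else n1" and ?nu = "\<lambda>i::nat. if i = 0 then nu0 else nu1"
  let ?J = "\<lambda>i::nat. if i = 0 then J0 else J1" and ?g = "\<lambda>i::nat. if i = 0 then g0 else g1"
  interpret lda_regime Sig ?mu ?m ?n ?nu ?J ?g
  proof
    fix a b assume "a \<in> {?m 0, ?m 1, ?mu 0, ?mu 1}" "b \<in> {?m 0, ?m 1, ?mu 0, ?mu 1}"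
    then show "convergent (\<lambda>p. bil p (Sig p) (a p) (b p))"
      by (intro conv) auto
  qed (use Sig nu_pos n_inf J gam in auto)
  have mem: "mu0 \<in> det_vecs" "mu1 \<in> det_vecs" "m0 \<in> det_vecs" "m1 \<in> det_vecs"
    by (simp_all add: det_vecs_def)
  have lim_eta: "lim (\<lambda>p. eta p (Sig p) (a p) (b p)) = K a a - 2 * K a b + K b b"
    if "a \<in> det_vecs" "b \<in> det_vecs" for a b
    by (rule limI[OF tendsto_eta[OF that]])
  define d2 where "d2 = lim (\<lambda>p. eta p (Sig p) (mu0 p) (mu1 p))"
  have d2: "d2 = K mu0 mu0 - 2 * K mu0 mu1 + K mu1 mu1"
    unfolding d2_def by (rule lim_eta[OF mem(1,2)])
  have D_eq: "D = d2 + J0 + J1"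
    unfolding D_def d2 by simp
  have D_pos: "D > 0"
    using Dpos unfolding D_eq d2_def .
  have g: "1 + g0 \<noteq> 0" "1 + g1 \<noteq> 0"
    using g_nonneg[of 0] g_nonneg[of 1] by auto
  define GB where "GB i = (if i = 0 then
       1 / (2 * (1 + g0)) * (g0 * (lim (\<lambda>p. eta p (Sig p) (m0 p) (mu1 p))
          - lim (\<lambda>p. eta p (Sig p) (m0 p) (mu0 p))) + d2 + (1 - g0) * J0 + (1 + g0) * J1)
     else
       -1 / (2 * (1 + g1)) * (g1 * (lim (\<lambda>p. eta p (Sig p) (m1 p) (mu0 p))
          - lim (\<lambda>p. eta p (Sig p) (m1 p) (mu1 p))) + d2 + (1 - g1) * J1 + (1 + g1) * J0))" for i :: nat
  define G where "G i = (if i = 0 then (d2 + J1 - J0) / 2 else - (d2 + J0 - J1) / 2)" for i :: nat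
  \<comment> \<open>Subtracting \<open>mid\<close> completes the inner products to half of
    \<open>d2\<close> and leaves half the difference of the J's.\<close>
  have G_eq: "K (?mu j) (?mu 0) - K (?mu j) (?mu 1) - mid = G j" if "j \<in> {0, 1}" for j
    using that K_commute[of mu1 mu0] by (auto simp: mid_def G_def d2 field_simps)
  \<comment> \<open>The limit of \<open>B\<close> at a prior mean with itself cancels in the
    difference of the two eta limits, leaving twice the difference of the pairings with the class
    means plus terms that \<open>mid\<close> absorbs.\<close>
  have GB_eq: "1 / (1 + ?g i) * (K (?mu i) (?mu 0) + (if i = 0 then ?J 0 else 0)
        - (K (?mu i) (?mu 1) + (if i = 1 then ?J 1 else 0)) - mid)
      + ?g i / (1 + ?g i) * (K (?m i) (?mu 0) - K (?m i) (?mu 1) - mid) = GB i" if "i \<in> {0, 1}" for i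
  proof -
    have "1 / (1 + g0) * (K mu0 mu0 + J0 - K mu0 mu1 - mid) + g0 / (1 + g0) * (K m0 mu0 - K m0 mu1 - mid) = GB 0"
      using g(1) unfolding GB_def lim_eta[OF mem(3,1)] lim_eta[OF mem(3,2)]
      by (simp add: mid_def d2 divide_simps) (simp add: algebra_simps)
    moreover have "1 / (1 + g1) * (K mu1 mu0 - (K mu1 mu1 + J1) - mid) + g1 / (1 + g1) * (K m1 mu0 - K m1 mu1 - mid) = GB 1"
      using g(2) K_commute[of mu1 mu0] unfolding GB_def lim_eta[OF mem(4,1)] lim_eta[OF mem(4,2)]
      by (simp add: mid_def d2 divide_simps) (simp add: algebra_simps)
    ultimately show ?thesis
      using that by auto
  qed
  let ?LB = "\<lambda>i. Phi ((-1) ^ i * ((- GB i + lda_c a0) / sqrt D))"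
  let ?LT = "\<lambda>j. Phi ((-1) ^ j * ((- G j + lda_c a0) / sqrt D))"
  let ?bayes = "\<lambda>i p X. eps_bayes a0 p (Sig p) (m0 p) (m1 p) (n0 p) (n1 p) (nu0 p) (nu1 p) i
      (smean p (n0 p) (fst X)) (smean p (n1 p) (snd X))"
  let ?true = "\<lambda>j p X. eps_true a0 p (Sig p) (mu0 p) (mu1 p) j
      (smean p (n0 p) (fst X)) (smean p (n1 p) (snd X))"
  have bayes: "tendsto_prob M (?bayes i) (?LB i)" if "i \<in> {0, 1}" for i
    using tendsto_prob_eps_bayes[OF D_pos that, of a0] unfolding GB_eq[OF that]
    by (simp add: xbar_def)
  have true: "tendsto_prob M (?true j) (?LT j)" if "j \<in> {0, 1}" for j
    using tendsto_prob_eps_true[OF D_pos that, of a0] unfolding G_eq[OF that]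
    by (simp add: xbar_def)
  \<comment> \<open>A product of two errors and its limit both lie in [0, 1], hence the bound
    \<open>B = 1\<close> below.\<close>
  have unit: "\<bar>x * y - x' * y'\<bar> \<le> 1" if "x \<in> {0..1}" "y \<in> {0..1}" "x' \<in> {0..1}" "y' \<in> {0..1}" for x y x' y' :: real
  proof -
    have "0 \<le> x * y" "x * y \<le> 1" "0 \<le> x' * y'" "x' * y' \<le> 1"
      using that by (auto intro: mult_le_one)
    then show ?thesis by linarith
  qed
  have Phi01: "Phi x \<in> {0..1}" for x using Phi_bounds by simp
  have bayes01: "?bayes i p X \<in> {0..1}" and true01: "?true i p X \<in> {0..1}" for i p X
    by (simp_all add: eps_bayes_def eps_true_def Let_def Phi_bounds)
  \<comment> \<open>The prior class probabilities form a convex combination, so the total errors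
    remain in [0, 1].\<close>
  have mix: "a0 * x + (1 - a0) * y \<in> {0..1}" if "x \<in> {0..1}" "y \<in> {0..1}" for x y :: real
    using convexD[of "{0..1::real}" x y a0 "1 - a0"] that a0 by simp
  have M_eq: "M p = sample_meas p (Sig p) (mu0 p) (mu1 p) (n0 p) (n1 p)" for p
    by (simp add: M_def)
  have part1: "(\<lambda>p. \<integral>X. ?bayes i p X * ?true j p X \<partial>M p) \<longlonglongrightarrow> ?LB i * ?LT j"
    if "i \<in> {0, 1}" "j \<in> {0, 1}" for i j
    by (intro tendsto_prob_bounded_integral[where B = 1] tendsto_prob_mult prob_space_M bayes true that
        unit bayes01 true01 Phi01)
  \<comment> \<open>The total product is a single bounded function to which the limit theorem
    applies directly, so the integral need not be split into four; only the constant limit is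
    expanded.\<close>
  have lim_tot: "(\<lambda>p. \<integral>X. (a0 * ?bayes 0 p X + (1 - a0) * ?bayes 1 p X) * (a0 * ?true 0 p X + (1 - a0) * ?true 1 p X) \<partial>M p)
      \<longlonglongrightarrow> (a0 * ?LB 0 + (1 - a0) * ?LB 1) * (a0 * ?LT 0 + (1 - a0) * ?LT 1)"
  proof (intro tendsto_prob_bounded_integral[where B = 1] prob_space_M unit mix bayes01 true01 Phi01)
    show "tendsto_prob M (\<lambda>p X. (a0 * ?bayes 0 p X + (1 - a0) * ?bayes 1 p X) * (a0 * ?true 0 p X + (1 - a0) * ?true 1 p X))
      ((a0 * ?LB 0 + (1 - a0) * ?LB 1) * (a0 * ?LT 0 + (1 - a0) * ?LT 1))"
      by (intro tendsto_prob_add tendsto_prob_mult prob_space_M tendsto_prob_const tendsto_const bayes true) simp_all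
  qed
  have expand: "(a0 * f 0 + (1 - a0) * f 1) * (a0 * h 0 + (1 - a0) * h 1) =
      (\<Sum>i\<in>{0,1}. \<Sum>j\<in>{0,1}. alpha a0 i * alpha a0 j * (f i * h j))" for f h :: "nat \<Rightarrow> real"
    by (simp add: alpha_def algebra_simps)
  have part2: "(\<lambda>p. \<integral>X. eps_bayes_tot a0 p (Sig p) (m0 p) (m1 p) (n0 p) (n1 p) (nu0 p) (nu1 p)
          (smean p (n0 p) (fst X)) (smean p (n1 p) (snd X))
        * eps_true_tot a0 p (Sig p) (mu0 p) (mu1 p)
          (smean p (n0 p) (fst X)) (smean p (n1 p) (snd X)) \<partial>M p)
      \<longlonglongrightarrow> (\<Sum>i\<in>{0,1}. \<Sum>j\<in>{0,1}. alpha a0 i * alpha a0 j * (?LB i * ?LT j))"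
    using lim_tot unfolding eps_bayes_tot_def eps_true_tot_def expand[of ?LB ?LT] .
  show ?thesis
    unfolding Let_def d2_def[symmetric]
    unfolding D_eq[symmetric] GB_def[symmetric] G_def[symmetric] M_eq[symmetric]
    by (intro conjI ballI part1 part2)
qed

end
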